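(* Let $f,g:\mathbb{R}^3\to\mathbb{R}^3$ be smooth ($C^\infty$) vector fields with $f(0)=0$, and consider the system $\dot x=f(x)+u\,g(x)$, $(x,u)\in\mathbb{R}^3\times\mathbb{R}$. Assume that: (I) $span\{g(x),[f,g](x),[f,[f,g]](x)\}=\mathbb{R}^3$ for all $x\in\mathbb{R}^3$; (II) there exists a smooth, positive definite and proper function $V:\mathbb{R}^3\to\mathbb{R}^+$ with $DV(x)\neq0$ for all $x\neq0$, such that either $$(gV)(x)=0\ \Rightarrow\ (fV)(x)<0,\qquad \forall x\neq0,$$ or $$(gV)(x)=0\ \Rightarrow\ (f^iV)(x)=0,\quad i=1,2,3,\qquad \forall x\neq0.$$ Then the system $\dot x=f(x)+u\,g(x)$ is SDF-SGAS.
   Context: Notation. $\mathbb{R}^+=[0,\infty)$; $|x|$ is the Euclidean norm; $B[0,R]=\{x\in\mathbb{R}^n:|x|\le R\}$. For $C^1$ maps $X:\mathbb{R}^n\to\mathbb{R}^k$, $Y:\mathbb{R}^k\to\mathbb{R}^\ell$, $XY:=(DY)X$, where $DY$ is the derivative of $Y$; in particular, for a vector field $X$ and a scalar function $V$, $(XV)(x)=DV(x)X(x)$. The Lie bracket of vector fields is $[X,Y]=XY-YX$. Also $f^1V:=fV$ and $f^iV:=f(f^{i-1}V)$ for $i\ge2$. A function $V:\mathbb{R}^n\to\mathbb{R}^+$ is positive definite if $V(0)=0$ and $V(x)>0$ for $x\ne0$, and proper if preimages of compact sets are compact. Definition (SDF-SGAS). A system $\dot x=F(x,u)$, $(x,u)\in\mathbb{R}^n\times\mathbb{R}^m$,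 $F(0,0)=0$, is Semi-Globally Asymptotically Stabilizable by Sampled-Data Feedback (SDF-SGAS) if for every $R>0$ and for any given partition of times $T_1:=0<T_2<T_3<\cdots<T_\nu<\cdots$ with $T_\nu\to\infty$ there exist a neighborhood $\Pi$ of zero with $B[0,R]\subset\Pi$ and a map $k:\mathbb{R}^+\times\Pi\to\mathbb{R}^m$ such that for any $x\in\Pi$ the map $k(\cdot,x):\mathbb{R}^+\to\mathbb{R}^m$ is measurable and locally essentially bounded, and the trajectory $x(\cdot)$ of the sampled-data closed-loop system $\dot x=F(x,k(t,x(T_i)))$, $t\in[T_i,T_{i+1})$, $i=1,2,\ldots$, $x(0)\in\Pi$, satisfies: Stability: for every $\varepsilon>0$ there is $\delta=\delta(\varepsilon)>0$ such that $x(0)\in\Pi$, $|x(0)|\le\delta$ imply $|x(t)|\le\varepsilon$ for all $t\ge0$; Attractivity: $\lim_{t\to\infty}x(t)=0$ for all $x(0)\in\Pi$. *)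

theory Defs
  imports "HOL-Analysis.Analysis"
begin

(* f is of class C^(Suc r) iff it is differentiable and all its directional derivatives
   are of class C^r; in finite dimensions this is continuity of all partial derivatives
   up to the given order. *)
primrec C_class :: "nat \<Rightarrow> ('a::euclidean_space \<Rightarrow> 'b::euclidean_space) \<Rightarrow> bool" where
  "C_class 0 f \<longleftrightarrow> continuous_on UNIV f"
| "C_class (Suc r) f \<longleftrightarrow>
     (\<forall>x. f differentiable (at x)) \<and>
     (\<forall>v. C_class r (\<lambda>x. frechet_derivative f (at x) v))"

definition smooth :: "('a::euclidean_space \<Rightarrow> 'b::euclidean_space) \<Rightarrow> bool" where
  "smooth f \<longleftrightarrow> (\<forall>r. C_class r f)"

(* XY = (DY)X; for scalar Y this is the Lie derivative of Y along X. *)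
definition lie_deriv ::
  "('a::euclidean_space \<Rightarrow> 'a) \<Rightarrow> ('a \<Rightarrow> 'b::euclidean_space) \<Rightarrow> 'a \<Rightarrow> 'b" where
  "lie_deriv X Y x = frechet_derivative Y (at x) (X x)"

(* [X,Y] = XY - YX *)
definition lie_bracket ::
  "('a::euclidean_space \<Rightarrow> 'a) \<Rightarrow> ('a \<Rightarrow> 'a) \<Rightarrow> 'a \<Rightarrow> 'a" where
  "lie_bracket X Y x = lie_deriv X Y x - lie_deriv Y X x"

definition positive_definite :: "('a::euclidean_space \<Rightarrow> real) \<Rightarrow> bool" where
  "positive_definite V \<longleftrightarrow> V 0 = 0 \<and> (\<forall>x. x \<noteq> 0 \<longrightarrow> V x > 0)"

(* Compact subsets of the codomain [0,\<infinity>). *)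
definition proper :: "('a::euclidean_space \<Rightarrow> real) \<Rightarrow> bool" where
  "proper V \<longleftrightarrow> (\<forall>K. K \<subseteq> {0..} \<and> compact K \<longrightarrow> compact (V -` K))"

(* A partition of [0,\<infinity>), indexed from 0. *)
definition time_partition :: "(nat \<Rightarrow> real) \<Rightarrow> bool" where
  "time_partition T \<longleftrightarrow> T 0 = 0 \<and> strict_mono T \<and> filterlim T at_top sequentially"

(* Lebesgue measurable and locally essentially bounded on [0,\<infinity>). *)
definition admissible_input :: "(real \<Rightarrow> 'b::euclidean_space) \<Rightarrow> bool" where
  "admissible_input u \<longleftrightarrow>
     u \<in> borel_measurable (lebesgue_on {0..}) \<and>
     (\<forall>K. compact K \<and> K \<subseteq> {0..} \<longrightarrow>
        (\<exists>C. AE t in lebesgue. t \<in> K \<longrightarrow> norm (u t) \<le> C))"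

(* Inputs are merely measurable in time, so trajectories on [0,\<infinity>) are Caratheodory
   solutions of x'(t) = F(x(t), k(t, x(T_i))) on each sampling interval; the values at the
   common endpoints agree by continuity. Only the values of x on [0,\<infinity>) matter. *)
definition sampled_trajectory ::
  "('a::euclidean_space \<Rightarrow> 'b::euclidean_space \<Rightarrow> 'a) \<Rightarrow> (nat \<Rightarrow> real) \<Rightarrow>
   (real \<Rightarrow> 'a \<Rightarrow> 'b) \<Rightarrow> (real \<Rightarrow> 'a) \<Rightarrow> bool" where
  "sampled_trajectory F T k x \<longleftrightarrow>
     (\<forall>i. \<forall>t\<in>{T i..T (Suc i)}.
        (\<lambda>s. F (x s) (k s (x (T i)))) absolutely_integrable_on {T i..t} \<and>
        x t = x (T i) + integral {T i..t} (\<lambda>s. F (x s) (k s (x (T i)))))"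

(* The feedback k(t,.) has domain P, whence the requirement that trajectories stay in P at
   the sampling times; the values of k outside P are irrelevant. *)
definition SDF_SGAS ::
  "('a::euclidean_space \<Rightarrow> 'b::euclidean_space \<Rightarrow> 'a) \<Rightarrow> bool" where
  "SDF_SGAS F \<longleftrightarrow>
     F 0 0 = 0 \<and>
     (\<forall>R>0. \<forall>T. time_partition T \<longrightarrow>
       (\<exists>P k. 0 \<in> interior P \<and> cball 0 R \<subseteq> P \<and>
         (\<forall>p\<in>P. admissible_input (\<lambda>t. k t p)) \<and>
         (\<forall>p\<in>P. \<exists>x. x 0 = p \<and> sampled_trajectory F T k x) \<and>
         (\<forall>x. x 0 \<in> P \<and> sampled_trajectory F T k x \<longrightarrow> (\<forall>i. x (T i) \<in> P)) \<and>
         (\<forall>\<epsilon>>0. \<exists>\<delta>>0. \<forall>x. x 0 \<in> P \<and> sampled_trajectory F T k x \<and> norm (x 0) \<le> \<delta> \<longrightarrow>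
            (\<forall>t\<ge>0. norm (x t) \<le> \<epsilon>)) \<and>
         (\<forall>x. x 0 \<in> P \<and> sampled_trajectory F T k x \<longrightarrow> (x \<longlongrightarrow> 0) at_top)))"

end

theory Submission
  imports Defs
begin

text \<open>
  The proof has a local and a global half.

  \<^bold>\<open>Local half.\<close> At every \<open>p \<noteq> 0\<close> some open-loop control decreases \<open>V\<close> in arbitrarily short
  time. If \<open>gV(p) \<noteq> 0\<close>, a large constant control does it, and if \<open>fV(p) < 0\<close>, so does the zero
  control. Otherwise \<open>gV\<close>, \<open>fV\<close>, \<open>f\<^sup>2V\<close>, \<open>f\<^sup>3V\<close> all vanish at \<open>p\<close>, and because \<open>DV(p) \<noteq> 0\<close> while
  the three fields span, \<open>[f,g]V(p)\<close> or \<open>[f,[f,g]]V(p)\<close> is nonzero. With a control of mean zero on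
  the time interval \<open>[0,\<tau>]\<close>, all that remains of the expansion of \<open>V\<close> up to order \<open>\<tau>\<^sup>2\<close> is a
  multiple of \<open>[f,g]V(p)\<close>, whose sign can be chosen. If that bracket vanishes on \<open>V\<close>, a control
  whose first moment vanishes too leaves, at order \<open>\<tau>\<^sup>3\<close>, a multiple of \<open>[f,[f,g]]V(p)\<close> that is
  linear in the amplitude, plus a term quadratic in it; small amplitude and the right sign give
  descent (\<open>exists_decreasing_control\<close>). As solutions depend continuously on the initial point, one
  control achieves a fixed decrease on a whole neighbourhood of \<open>p\<close> (\<open>local_descent\<close>).

  \<^bold>\<open>Global half.\<close> Concatenating such controls, and using compactness of the sublevel sets, one
  can steer any \<open>q\<close> into any sublevel set of \<open>V\<close> in finite time while \<open>V\<close> stays below \<open>2V(q)\<close>, and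
  then keep it there for as long as desired (\<open>descend_and_wait\<close>). Such a manoeuvre may last for many
  sampling intervals, and no lower bound on the lengths of the intervals is given, so that the decrease
  achievable within a single interval may be too small to be summed to infinity. The feedback
  therefore has to pursue long-term plans, although it sees only the time and the last sampled
  state. Dynamic programming resolves this: let \<open>level j = 4\<^sup>-\<^sup>j\<close>, call \<open>j\<close> attainable at \<open>(T\<^sub>i, q)\<close> if
  some control steers \<open>q\<close>, within \<open>V \<le> 2 level j\<close>, to \<open>V \<le> level (j+1)\<close> in some number \<open>m\<close> of
  sampling intervals, and let the feedback apply the first piece of a plan with the greatest
  attainable \<open>j\<close> and the least \<open>m\<close> (and the zero control at \<open>q = 0\<close>). The remainder of that plan is available at the next
  sampling time, so that \<open>j\<close> never decreases, and \<open>m\<close> drops as long as \<open>j\<close> stays the same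
  (\<open>feedback_exists\<close>). Hence every \<open>j\<close> becomes attainable along every trajectory, which is attractivity,
  while \<open>V \<le> 2 level j\<close> throughout gives stability.
\<close>

section \<open>Calculus of smooth maps and Lie derivatives\<close>

lemma frechet_derivative_apply:
  "(F has_derivative F') (at x) \<Longrightarrow> frechet_derivative F (at x) v = F' v"
  using frechet_derivative_at[of F F' x] by simp

lemma C_class_bounded_linear:
  assumes "bounded_linear h" and "C_class r F"
  shows "C_class r (\<lambda>x. h (F x))"
  using assms(2)
proof (induction r arbitrary: F)
  case 0
  then show ?case
    using linear_continuous_on_compose[OF _ bounded_linear.linear[OF assms(1)]]
    by simp
next
  case (Suc r)
  interpret h: bounded_linear h by fact
  have d: "((\<lambda>x. h (F x)) has_derivative (\<lambda>v. h (frechet_derivative F (at x) v))) (at x)" for x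
    using Suc.prems by (intro h.has_derivative) (simp add: frechet_derivative_works)
  have "frechet_derivative (\<lambda>x. h (F x)) (at x) = (\<lambda>v. h (frechet_derivative F (at x) v))" for x
    using frechet_derivative_at[OF d] by simp
  moreover have "(\<lambda>x. h (F x)) differentiable (at x)" for x
    using d unfolding differentiable_def by blast
  ultimately show ?case
    using Suc by simp
qed

lemma C_class_const: "C_class r (\<lambda>x. c)"
proof (induction r arbitrary: c)
  case (Suc r)
  have "frechet_derivative (\<lambda>x::'a. c) (at x) = (\<lambda>v. 0)" for x
    by (intro ext frechet_derivative_apply has_derivative_const)
  then show ?case using Suc by (auto simp: differentiable_const)
qed auto

lemma C_class_add:
  assumes "C_class r F" "C_class r G"
  shows "C_class r (\<lambda>x. F x + G x)"
  using assms
proof (induction r arbitrary: F G)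
  case 0
  then show ?case by (auto intro: continuous_on_add)
next
  case (Suc r)
  have d: "((\<lambda>x. F x + G x) has_derivative
      (\<lambda>v. frechet_derivative F (at x) v + frechet_derivative G (at x) v)) (at x)" for x
    using Suc.prems by (intro has_derivative_add) (simp_all add: frechet_derivative_works)
  have "frechet_derivative (\<lambda>x. F x + G x) (at x) =
      (\<lambda>v. frechet_derivative F (at x) v + frechet_derivative G (at x) v)" for x
    using frechet_derivative_at[OF d] by simp
  moreover have "(\<lambda>x. F x + G x) differentiable (at x)" for x
    using d unfolding differentiable_def by blast
  ultimately show ?case
    using Suc by simp
qed

lemma C_class_sum:
  assumes "finite S" "\<And>i. i \<in> S \<Longrightarrow> C_class r (F i)"
  shows "C_class r (\<lambda>x. \<Sum>i\<in>S. F i x)"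
  using assms by (induction S rule: finite_induct) (auto intro: C_class_const C_class_add)

lemma C_class_SucD: "C_class (Suc r) F \<Longrightarrow> C_class r F"
proof (induction r arbitrary: F)
  case 0
  then show ?case
    by (auto intro!: continuous_at_imp_continuous_on differentiable_imp_continuous_within)
next
  case (Suc r)
  show ?case
    using Suc.prems Suc.IH unfolding C_class.simps(2)[of "Suc r"] C_class.simps(2)[of r F]
    by blast
qed

lemma C_class_bilinear:
  assumes "bounded_bilinear h" and "C_class r F" "C_class r G"
  shows "C_class r (\<lambda>x. h (F x) (G x))"
  using assms(2-)
proof (induction r arbitrary: F G)
  case 0
  then show ?case using bounded_bilinear.continuous_on[OF assms(1)] by auto
next
  case (Suc r)
  have d: "((\<lambda>x. h (F x) (G x)) has_derivative
      (\<lambda>v. h (F x) (frechet_derivative G (at x) v) + h (frechet_derivative F (at x) v) (G x))) (at x)" for x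
    using Suc.prems
    by (intro bounded_bilinear.FDERIV[OF assms(1)]) (simp_all add: frechet_derivative_works)
  have e: "frechet_derivative (\<lambda>x. h (F x) (G x)) (at x) =
      (\<lambda>v. h (F x) (frechet_derivative G (at x) v) + h (frechet_derivative F (at x) v) (G x))" for x
    using frechet_derivative_at[OF d] by simp
  have "C_class r F" "C_class r G"
    using Suc.prems by (auto intro: C_class_SucD simp del: C_class.simps)
  moreover have "(\<lambda>x. h (F x) (G x)) differentiable (at x)" for x
    using d unfolding differentiable_def by blast
  ultimately show ?case
    using Suc.prems Suc.IH unfolding C_class.simps(2) e
    by (intro conjI allI C_class_add) blast+
qed

lemma smooth_differentiable: "smooth F \<Longrightarrow> F differentiable (at x)"
  unfolding smooth_def using C_class.simps(2) by blast

lemma smooth_has_derivative: "smooth F \<Longrightarrow> (F has_derivative frechet_derivative F (at x)) (at x)"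
  using smooth_differentiable frechet_derivative_works by blast

lemma smooth_continuous_on: "smooth F \<Longrightarrow> continuous_on S F"
  unfolding smooth_def using C_class.simps(1) continuous_on_subset by blast

lemma smooth_directional: "smooth F \<Longrightarrow> smooth (\<lambda>x. frechet_derivative F (at x) v)"
  unfolding smooth_def using C_class.simps(2) by blast

text \<open>Reduces questions about Lie derivatives, whose direction varies with the point, to the
  directional derivatives along fixed basis vectors that \<open>C_class\<close> speaks about.\<close>
lemma derivative_expand_Basis:
  fixes F :: "'a::euclidean_space \<Rightarrow> 'b::euclidean_space"
  assumes "F differentiable (at x)"
  shows "frechet_derivative F (at x) v = (\<Sum>b\<in>Basis. (v \<bullet> b) *\<^sub>R frechet_derivative F (at x) b)"
proof -
  interpret D: bounded_linear "frechet_derivative F (at x)"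
    using assms frechet_derivative_works has_derivative_bounded_linear by blast
  have "frechet_derivative F (at x) v = frechet_derivative F (at x) (\<Sum>b\<in>Basis. (v \<bullet> b) *\<^sub>R b)"
    by (simp add: euclidean_representation)
  then show ?thesis
    by (simp only: D.sum D.scaleR)
qed

lemma smooth_lie_deriv:
  assumes "smooth X" "smooth F"
  shows "smooth (lie_deriv X F)"
proof -
  have eq: "lie_deriv X F = (\<lambda>x. \<Sum>b\<in>Basis. (X x \<bullet> b) *\<^sub>R frechet_derivative F (at x) b)"
    unfolding lie_deriv_def using derivative_expand_Basis[OF smooth_differentiable[OF assms(2)]]
    by blast
  have 1: "C_class r (\<lambda>x. X x \<bullet> b)" for r b
    using assms(1) C_class_bounded_linear[OF bounded_linear_inner_left] by (auto simp: smooth_def)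
  have 2: "C_class r (\<lambda>x. frechet_derivative F (at x) b)" for r b
    using smooth_directional[OF assms(2)] by (auto simp: smooth_def)
  show ?thesis
    unfolding smooth_def eq
    by (intro allI C_class_sum finite_Basis C_class_bilinear[OF bounded_bilinear_scaleR] 1 2)
qed

lemma smooth_lipschitz_on_cball:
  fixes F :: "'a::euclidean_space \<Rightarrow> 'b::euclidean_space"
  assumes "smooth F"
  obtains L where "L > 0" "\<And>x y. x \<in> cball p r \<Longrightarrow> y \<in> cball p r \<Longrightarrow> norm (F x - F y) \<le> L * norm (x - y)"
proof -
  have "\<exists>B. \<forall>x\<in>cball p r. norm (frechet_derivative F (at x) b) \<le> B" for b
  proof -
    have "compact ((\<lambda>x. frechet_derivative F (at x) b) ` cball p r)"
      by (intro compact_continuous_image smooth_continuous_on smooth_directional assms) simp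
    then show ?thesis
      by (auto dest!: compact_imp_bounded simp: bounded_iff)
  qed
  then obtain B where B: "norm (frechet_derivative F (at x) b) \<le> B b" if "x \<in> cball p r" for b x
    by metis
  define L where "L = max 1 (\<Sum>b\<in>Basis. B b)"
  have on: "onorm (frechet_derivative F (at x)) \<le> L" if x: "x \<in> cball p r" for x
  proof (rule onorm_le)
    fix v :: 'a
    have "norm (frechet_derivative F (at x) v) \<le> (\<Sum>b\<in>Basis. norm ((v \<bullet> b) *\<^sub>R frechet_derivative F (at x) b))"
      unfolding derivative_expand_Basis[OF smooth_differentiable[OF assms], of x v] by (rule norm_sum)
    also have "\<dots> \<le> (\<Sum>b\<in>Basis. norm v * B b)"
      using B[OF x] Basis_le_norm by (intro sum_mono) (auto intro!: mult_mono)
    also have "\<dots> \<le> L * norm v"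
      unfolding sum_distrib_left[symmetric] L_def by (simp add: mult.commute mult_left_mono)
    finally show "norm (frechet_derivative F (at x) v) \<le> L * norm v" .
  qed
  show thesis
  proof (rule that)
    show "L > 0" by (simp add: L_def)
    show "norm (F x - F y) \<le> L * norm (x - y)" if "x \<in> cball p r" "y \<in> cball p r" for x y
      by (rule differentiable_bound[OF convex_cball _ on that])
         (auto intro: has_derivative_at_withinI smooth_has_derivative[OF assms])
  qed
qed

lemma mvt_along_line:
  fixes W :: "'a::euclidean_space \<Rightarrow> real"
  assumes "\<And>x. W differentiable (at x)" "h > 0"
  obtains s where "0 < s" "s < h"
    "W (x + h *\<^sub>R v) - W x = h * frechet_derivative W (at (x + s *\<^sub>R v)) v"
proof -
  have d: "((\<lambda>s. W (x + s *\<^sub>R v)) has_real_derivative frechet_derivative W (at (x + s *\<^sub>R v)) v) (at s)" for s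
  proof -
    have W: "(W has_derivative frechet_derivative W (at (x + s *\<^sub>R v))) (at (x + s *\<^sub>R v))"
      using assms(1) frechet_derivative_works by blast
    have "((\<lambda>s. W (x + s *\<^sub>R v)) has_derivative (\<lambda>t. frechet_derivative W (at (x + s *\<^sub>R v)) (t *\<^sub>R v))) (at s)"
      by (rule has_derivative_compose[where g=W and x=s and f="\<lambda>s. x + s *\<^sub>R v"])
         (auto intro!: derivative_eq_intros W)
    moreover have "frechet_derivative W (at (x + s *\<^sub>R v)) (t *\<^sub>R v) = frechet_derivative W (at (x + s *\<^sub>R v)) v * t" for t
      using linear_scale[OF bounded_linear.linear[OF has_derivative_bounded_linear[OF W]]] by simp
    ultimately show ?thesis by (simp add: has_field_derivative_def)
  qed
  from MVT2[of 0 h "\<lambda>s. W (x + s *\<^sub>R v)", OF assms(2) d]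
  show thesis using that by auto
qed

text \<open>The double difference of \<open>W\<close> over the parallelogram with sides \<open>h v\<close> and \<open>h w\<close> is symmetric in
  \<open>v\<close> and \<open>w\<close>, and by the mean value theorem it equals \<open>h\<^sup>2\<close> times either mixed derivative at some
  point near \<open>x\<close>; continuity gives the claim as \<open>h\<close> tends to 0.\<close>
lemma symmetric_second_derivative:
  fixes W :: "'a::euclidean_space \<Rightarrow> real"
  assumes "smooth W"
  shows "frechet_derivative (\<lambda>x. frechet_derivative W (at x) v) (at x) w
       = frechet_derivative (\<lambda>x. frechet_derivative W (at x) w) (at x) v"
proof -
  define D where "D v w x = frechet_derivative (\<lambda>x. frechet_derivative W (at x) v) (at x) w" for v w x
  have D_cont: "isCont (D v w) x" for v w x
    unfolding D_def
    using smooth_continuous_on[OF smooth_directional[OF smooth_directional[OF assms]], of UNIV]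
    by (simp add: continuous_on_eq_continuous_at)
  \<comment> \<open>One double difference quotient, computed by the mean value theorem in the two orders.\<close>
  have key: "\<exists>z. norm (z - x) \<le> h * (norm v + norm w) \<and>
     W (x + h *\<^sub>R v + h *\<^sub>R w) - W (x + h *\<^sub>R v) - W (x + h *\<^sub>R w) + W x = h * h * D v w z"
    if h: "h > 0" for h v w
  proof -
    have dW: "W differentiable (at y)" for y by (rule smooth_differentiable[OF assms])
    define G where "G = (\<lambda>y. W (y + h *\<^sub>R w) - W y)"
    have dG: "(G has_derivative (\<lambda>u. frechet_derivative W (at (y + h *\<^sub>R w)) u - frechet_derivative W (at y) u)) (at y)" for y
      unfolding G_def
      by (auto intro!: derivative_eq_intros smooth_has_derivative[OF assms]
           has_derivative_compose[OF _ smooth_has_derivative[OF assms]])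
    have G': "frechet_derivative G (at y) u = frechet_derivative W (at (y + h *\<^sub>R w)) u - frechet_derivative W (at y) u" for y u
      using frechet_derivative_apply[OF dG] .
    obtain s where s: "0 < s" "s < h" "G (x + h *\<^sub>R v) - G x = h * frechet_derivative G (at (x + s *\<^sub>R v)) v"
      using mvt_along_line[of G h x v] dG h differentiable_def by blast
    obtain t where t: "0 < t" "t < h" "frechet_derivative W (at (x + s *\<^sub>R v + h *\<^sub>R w)) v - frechet_derivative W (at (x + s *\<^sub>R v)) v
         = h * D v w (x + s *\<^sub>R v + t *\<^sub>R w)"
      using mvt_along_line[of "\<lambda>x. frechet_derivative W (at x) v" h "x + s *\<^sub>R v" w]
        smooth_differentiable[OF smooth_directional[OF assms]] h unfolding D_def by blast
    have "W (x + h *\<^sub>R v + h *\<^sub>R w) - W (x + h *\<^sub>R v) - W (x + h *\<^sub>R w) + W x = h * h * D v w (x + s *\<^sub>R v + t *\<^sub>R w)"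
      using s(3) t(3) unfolding G' by (simp add: G_def)
    moreover have "norm (s *\<^sub>R v + t *\<^sub>R w) \<le> h * (norm v + norm w)"
      using s t by (intro order_trans[OF norm_triangle_ineq]) (auto simp: distrib_left intro!: add_mono mult_right_mono)
    ultimately show ?thesis
      by (intro exI[of _ "x + s *\<^sub>R v + t *\<^sub>R w"]) (simp add: add.assoc)
  qed
  have "D v w x = D w v x"
  proof (rule ccontr)
    assume ne: "D v w x \<noteq> D w v x"
    define e where "e = \<bar>D v w x - D w v x\<bar> / 2"
    have e: "e > 0" using ne by (simp add: e_def)
    obtain d1 where d1: "d1 > 0" "\<And>y. norm (y - x) < d1 \<Longrightarrow> \<bar>D v w y - D v w x\<bar> < e"
      using D_cont[where v=v and w=w and x=x, unfolded continuous_at_eps_delta, rule_format, OF e]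
      unfolding dist_real_def unfolding dist_norm by meson
    obtain d2 where d2: "d2 > 0" "\<And>y. norm (y - x) < d2 \<Longrightarrow> \<bar>D w v y - D w v x\<bar> < e"
      using D_cont[where v=w and w=v and x=x, unfolded continuous_at_eps_delta, rule_format, OF e]
      unfolding dist_real_def unfolding dist_norm by meson
    define N where "N = norm v + norm w + 1"
    have N: "N > 0" unfolding N_def by (smt (verit) norm_ge_zero)
    define h where "h = min d1 d2 / (2 * N)"
    have h: "h > 0" using d1(1) d2(1) N by (simp add: h_def)
    have hN: "h * (norm v + norm w) < min d1 d2"
    proof -
      have "h * (norm v + norm w) \<le> h * N" using h by (simp add: N_def)
      also have "\<dots> = min d1 d2 / 2" using N by (simp add: h_def)
      also have "\<dots> < min d1 d2" using d1(1) d2(1) by (simp add: min_def)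
      finally show ?thesis .
    qed
    obtain z1 where z1: "norm (z1 - x) \<le> h * (norm v + norm w)"
      "W (x + h *\<^sub>R v + h *\<^sub>R w) - W (x + h *\<^sub>R v) - W (x + h *\<^sub>R w) + W x = h * h * D v w z1"
      using key[OF h] by blast
    obtain z2 where z2: "norm (z2 - x) \<le> h * (norm w + norm v)"
      "W (x + h *\<^sub>R w + h *\<^sub>R v) - W (x + h *\<^sub>R w) - W (x + h *\<^sub>R v) + W x = h * h * D w v z2"
      using key[OF h] by blast
    have "h * h * D v w z1 = h * h * D w v z2"
      using z1(2) z2(2) by (simp add: algebra_simps)
    then have "D v w z1 = D w v z2" using h by simp
    moreover have "\<bar>D v w z1 - D v w x\<bar> < e" using d1(2) z1(1) hN by auto
    moreover have "\<bar>D w v z2 - D w v x\<bar> < e" using d2(2) z2(1) hN by (auto simp: add.commute)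
    ultimately show False unfolding e_def by (smt (verit) field_sum_of_halves)
  qed
  then show ?thesis by (simp add: D_def)
qed

text \<open>The product rule for \<open>DW(y)(X(y))\<close>: the second summand differentiates \<open>DW\<close> with the direction
  \<open>X(x)\<close> frozen, which is the part that \<open>symmetric_second_derivative\<close> applies to.\<close>
lemma derivative_of_lie_deriv:
  fixes W :: "'a::euclidean_space \<Rightarrow> real"
  assumes "smooth X" "smooth W"
  shows "frechet_derivative (lie_deriv X W) (at x) v
    = frechet_derivative W (at x) (frechet_derivative X (at x) v)
      + frechet_derivative (\<lambda>y. frechet_derivative W (at y) (X x)) (at x) v"
proof -
  have eq: "lie_deriv X W = (\<lambda>y. \<Sum>b\<in>Basis. (X y \<bullet> b) * frechet_derivative W (at y) b)"
    unfolding lie_deriv_def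
    using derivative_expand_Basis[OF smooth_differentiable[OF assms(2)], unfolded real_scaleR_def]
    by blast
  have eq2: "(\<lambda>y. frechet_derivative W (at y) u) = (\<lambda>y. \<Sum>b\<in>Basis. (u \<bullet> b) * frechet_derivative W (at y) b)" for u
    using derivative_expand_Basis[OF smooth_differentiable[OF assms(2)], unfolded real_scaleR_def]
    by blast
  let ?W = "\<lambda>b v. frechet_derivative (\<lambda>y. frechet_derivative W (at y) b) (at x) v"
  have d2: "((\<lambda>y. frechet_derivative W (at y) b) has_derivative ?W b) (at x)" for b
    by (rule smooth_has_derivative[OF smooth_directional[OF assms(2)]])
  have "(lie_deriv X W has_derivative (\<lambda>v. \<Sum>b\<in>Basis. (X x \<bullet> b) * ?W b v
      + (frechet_derivative X (at x) v \<bullet> b) * frechet_derivative W (at x) b)) (at x)"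
    unfolding eq
    by (rule has_derivative_sum)
       (rule has_derivative_mult[OF has_derivative_inner_left[OF smooth_has_derivative[OF assms(1)]] d2])
  then have "frechet_derivative (lie_deriv X W) (at x) v = (\<Sum>b\<in>Basis. (X x \<bullet> b) * ?W b v
      + (frechet_derivative X (at x) v \<bullet> b) * frechet_derivative W (at x) b)"
    by (rule frechet_derivative_apply)
  moreover have "((\<lambda>y. frechet_derivative W (at y) (X x)) has_derivative (\<lambda>v. \<Sum>b\<in>Basis. (X x \<bullet> b) * ?W b v)) (at x)"
    unfolding eq2[of "X x"] by (rule has_derivative_sum) (rule has_derivative_mult_right[OF d2])
  then have "?W (X x) v = (\<Sum>b\<in>Basis. (X x \<bullet> b) * ?W b v)"
    by (rule frechet_derivative_apply)
  moreover have "frechet_derivative W (at x) (frechet_derivative X (at x) v)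
     = (\<Sum>b\<in>Basis. (frechet_derivative X (at x) v \<bullet> b) * frechet_derivative W (at x) b)"
    using fun_cong[OF eq2] .
  ultimately show ?thesis
    by (simp add: sum.distrib)
qed

text \<open>Both second-order terms are the Hessian of \<open>W\<close> at \<open>(X,Y)\<close>, hence cancel.\<close>
lemma lie_deriv_lie_bracket:
  fixes W :: "'a::euclidean_space \<Rightarrow> real"
  assumes "smooth X" "smooth Y" "smooth W"
  shows "lie_deriv (lie_bracket X Y) W x
       = lie_deriv X (lie_deriv Y W) x - lie_deriv Y (lie_deriv X W) x"
proof -
  interpret D: bounded_linear "frechet_derivative W (at x)"
    using smooth_has_derivative[OF assms(3)] has_derivative_bounded_linear by blast
  show ?thesis
    unfolding lie_deriv_def[of X "lie_deriv Y W"] lie_deriv_def[of Y "lie_deriv X W"]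
      derivative_of_lie_deriv[OF assms(1,3)] derivative_of_lie_deriv[OF assms(2,3)]
      symmetric_second_derivative[OF assms(3), of "Y x" x "X x"]
    by (simp add: lie_deriv_def lie_bracket_def D.diff)
qed

lemma smooth_diff: "smooth F \<Longrightarrow> smooth G \<Longrightarrow> smooth (\<lambda>x. F x - G x)"
  unfolding smooth_def diff_conv_add_uminus
  by (intro allI C_class_add C_class_bounded_linear[OF bounded_linear_minus[OF bounded_linear_ident]]) auto

lemma smooth_lie_bracket: "smooth X \<Longrightarrow> smooth Y \<Longrightarrow> smooth (lie_bracket X Y)"
  using smooth_diff[OF smooth_lie_deriv smooth_lie_deriv, of X Y Y X]
  by (simp add: lie_bracket_def[abs_def])

lemma lie_deriv_bracket_bracket:
  fixes W :: "'a::euclidean_space \<Rightarrow> real"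
  assumes "smooth X" "smooth Y" "smooth W"
  shows "lie_deriv (lie_bracket X (lie_bracket X Y)) W x
       = lie_deriv X (lie_deriv X (lie_deriv Y W)) x - 2 * lie_deriv X (lie_deriv Y (lie_deriv X W)) x
         + lie_deriv Y (lie_deriv X (lie_deriv X W)) x"
proof -
  have "lie_deriv (lie_bracket X Y) W = (\<lambda>x. lie_deriv X (lie_deriv Y W) x - lie_deriv Y (lie_deriv X W) x)"
    using lie_deriv_lie_bracket[OF assms] by auto
  moreover have "lie_deriv X (\<lambda>x. lie_deriv X (lie_deriv Y W) x - lie_deriv Y (lie_deriv X W) x) x
     = lie_deriv X (lie_deriv X (lie_deriv Y W)) x - lie_deriv X (lie_deriv Y (lie_deriv X W)) x"
    using frechet_derivative_at[OF has_derivative_diff[OF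
          smooth_has_derivative[OF smooth_lie_deriv[OF assms(1) smooth_lie_deriv[OF assms(2,3)]]]
          smooth_has_derivative[OF smooth_lie_deriv[OF assms(2) smooth_lie_deriv[OF assms(1,3)]]], of x]]
    by (simp add: lie_deriv_def fun_eq_iff)
  ultimately show ?thesis
    using lie_deriv_lie_bracket[OF assms(1) smooth_lie_bracket[OF assms(1,2)] assms(3)]
      lie_deriv_lie_bracket[OF assms(1,2) smooth_lie_deriv[OF assms(1,3)]]
    by simp
qed

section \<open>Short-time solutions of the control system\<close>

text \<open>The Picard operator, with its upper limit of integration clamped to \<open>[0,1]\<close>, contracts the bounded
  continuous functions on the real line by the factor \<open>1/2\<close>. The time interval is
  normalised to \<open>[0,1]\<close>, with its actual length as a factor in \<open>G\<close>, since later the control is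
  rescaled together with the interval. The contraction also gives the Lipschitz dependence on the initial
  value.\<close>
lemma picard_unit_interval:
  fixes G :: "real \<Rightarrow> 'a::euclidean_space \<Rightarrow> 'a"
  assumes cont: "\<And>y. continuous_on {0..1} y \<Longrightarrow> continuous_on {0..1} (\<lambda>s. G s (y s))"
    and bound: "\<And>s y. s \<in> {0..1} \<Longrightarrow> norm (G s y) \<le> M"
    and lip: "\<And>s y z. s \<in> {0..1} \<Longrightarrow> norm (G s y - G s z) \<le> norm (y - z) / 2"
  obtains Y where "\<And>q. Y q 0 = q"
    "\<And>q s. s \<in> {0..1} \<Longrightarrow> (Y q has_vector_derivative G s (Y q s)) (at s within {0..1})"
    "\<And>q s. s \<in> {0..1} \<Longrightarrow> norm (Y q s - q) \<le> M"
    "\<And>q q' s. s \<in> {0..1} \<Longrightarrow> norm (Y q s - Y q' s) \<le> 2 * norm (q - q')"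
    "\<And>q s. \<forall>r\<in>{0..1}. G r q = 0 \<Longrightarrow> s \<in> {0..1} \<Longrightarrow> Y q s = q"
proof -
  define c :: "real \<Rightarrow> real" where "c t = max 0 (min 1 t)" for t
  have c_in: "c t \<in> {0..1}" and c_id: "t \<in> {0..1} \<Longrightarrow> c t = t" for t
    by (auto simp: c_def)
  have c_cont: "continuous_on UNIV c"
    unfolding c_def by (intro continuous_intros)
  define I where "I y t = integral {0..t} (\<lambda>s. G s (y s))" for y :: "real \<Rightarrow> 'a" and t
  have int: "(\<lambda>s. G s (y s)) integrable_on {0..t}" if "continuous_on {0..1} y" "t \<in> {0..1}" for y t
    using that by (intro integrable_continuous_real continuous_on_subset[OF cont]) auto
  have I_cont: "continuous_on UNIV (\<lambda>t. I y (c t))" if "continuous_on {0..1} y" for y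
    unfolding I_def using c_in
    by (intro continuous_on_compose2[OF indefinite_integral_continuous_1[OF int[OF that, of 1]] c_cont]) auto
  have I_bound: "norm (I y t) \<le> M" if y: "continuous_on {0..1} y" and t: "t \<in> {0..1}" for y t
  proof -
    have "norm (I y t) \<le> M * (t - 0)"
      unfolding I_def using t bound
      by (intro integral_bound continuous_on_subset[OF cont[OF y]]) auto
    also have "\<dots> \<le> M"
      using t bound[of 0 0] norm_ge_zero[of "G 0 0"] by (auto intro: mult_left_le simp del: norm_ge_zero)
    finally show ?thesis .
  qed
  have I_diff: "norm (I y t - I z t) \<le> D / 2"
    if y: "continuous_on {0..1} y" "continuous_on {0..1} z" and t: "t \<in> {0..1}"
      and D: "\<And>s. s \<in> {0..1} \<Longrightarrow> norm (y s - z s) \<le> D" for y z t D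
  proof -
    have "I y t - I z t = integral {0..t} (\<lambda>s. G s (y s) - G s (z s))"
      unfolding I_def using int y t by (intro integral_diff[symmetric]) auto
    also have "norm \<dots> \<le> D / 2 * (t - 0)"
    proof (rule integral_bound)
      show "continuous_on {0..t} (\<lambda>s. G s (y s) - G s (z s))"
        using t by (intro continuous_on_diff continuous_on_subset[OF cont] y) auto
      show "norm (G s (y s) - G s (z s)) \<le> D / 2" if "s \<in> {0..t}" for s
        using that t D[of s] lip[of s "y s" "z s"] by auto
    qed (use t in auto)
    also have "\<dots> \<le> D / 2"
      using t D[of 0] norm_ge_zero[of "y 0 - z 0"] by (auto intro: mult_left_le simp del: norm_ge_zero)
    finally show ?thesis .
  qed
  define \<Phi> where "\<Phi> q y = Bcontfun (\<lambda>t. q + I (apply_bcontfun y) (c t))" for q y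
  have \<Phi>: "apply_bcontfun (\<Phi> q y) t = q + I (apply_bcontfun y) (c t)" for q y t
  proof -
    have "(\<lambda>t. q + I (apply_bcontfun y) (c t)) \<in> bcontfun"
    proof (rule bcontfun_normI)
      show "continuous_on UNIV (\<lambda>t. q + I (apply_bcontfun y) (c t))"
        by (intro continuous_on_add continuous_on_const I_cont) auto
      show "norm (q + I (apply_bcontfun y) (c t)) \<le> norm q + M" for t
        using I_bound[OF _ c_in] by (intro order_trans[OF norm_triangle_ineq]) auto
    qed
    then show ?thesis by (simp add: \<Phi>_def Bcontfun_inverse)
  qed
  have contr: "dist (\<Phi> q y) (\<Phi> q z) \<le> 1/2 * dist y z" for q y z
  proof (rule dist_bound)
    fix t
    show "dist (apply_bcontfun (\<Phi> q y) t) (apply_bcontfun (\<Phi> q z) t) \<le> 1/2 * dist y z"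
      using I_diff[of "apply_bcontfun y" "apply_bcontfun z" "c t" "dist y z"] c_in
        dist_bounded[of y _ z]
      by (simp add: \<Phi> dist_norm)
  qed
  have "\<exists>y. \<Phi> q y = y" for q
    using banach_fix_type[of "1/2" "\<Phi> q"] contr by auto
  then obtain Z where Z: "\<Phi> q (Z q) = Z q" for q by metis
  define Y where "Y q = apply_bcontfun (Z q)" for q
  have Y_cont: "continuous_on S (Y q)" for S q by (simp add: Y_def)
  have Y: "Y q s = q + I (Y q) (c s)" for q s
    unfolding Y_def using \<Phi>[of q "Z q" s] Z by simp
  have Y': "Y q s = q + I (Y q) s" if "s \<in> {0..1}" for q s
    using Y[of q s] c_id[OF that] by simp
  show thesis
  proof (rule that[of Y])
    show "Y q 0 = q" for q using Y'[of 0 q] by (simp add: I_def)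
    show "(Y q has_vector_derivative G s (Y q s)) (at s within {0..1})" if s: "s \<in> {0..1}" for q s
    proof (rule has_vector_derivative_transform[OF s])
      show "((\<lambda>t. q + I (Y q) t) has_vector_derivative G s (Y q s)) (at s within {0..1})"
        unfolding I_def
        using integral_has_vector_derivative[OF cont[OF Y_cont] s]
        by (auto intro!: derivative_eq_intros)
    qed (use Y' in auto)
    show "norm (Y q s - q) \<le> M" if "s \<in> {0..1}" for q s
      using Y'[OF that, of q] I_bound[OF Y_cont that, of q] by simp
    show "norm (Y q s - Y q' s) \<le> 2 * norm (q - q')" if s: "s \<in> {0..1}" for q q' s
    proof -
      define D where "D = dist (Z q) (Z q')"
      have D: "norm (Y q t - Y q' t) \<le> D" for t
        unfolding Y_def D_def using dist_bounded[of "Z q" t "Z q'"] by (simp add: dist_norm)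
      have "D \<le> norm (q - q') + D / 2"
        unfolding D_def
      proof (rule dist_bound)
        fix t
        have "Y q t - Y q' t = (q - q') + (I (Y q) (c t) - I (Y q') (c t))"
          using Y[of q t] Y[of q' t] by simp
        also have "norm \<dots> \<le> norm (q - q') + D / 2"
          using I_diff[OF Y_cont Y_cont c_in D] by (intro order_trans[OF norm_triangle_ineq]) auto
        finally show "dist (apply_bcontfun (Z q) t) (apply_bcontfun (Z q') t)
            \<le> norm (q - q') + dist (Z q) (Z q') / 2"
          by (simp add: dist_norm Y_def D_def)
      qed
      with D[of s] show ?thesis by linarith
    qed
    show "Y q s = q" if eq: "\<forall>r\<in>{0..1}. G r q = 0" and s: "s \<in> {0..1}" for q s
    proof -
      define D where "D = dist (Z q) (const_bcontfun q)"
      have D: "norm (Y q t - q) \<le> D" for t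
        unfolding Y_def D_def using dist_bounded[of "Z q" t "const_bcontfun q"] by (simp add: dist_norm)
      have I0: "I (\<lambda>r. q) (c t) = 0" for t
        unfolding I_def using eq c_in[of t] by (intro integral_unique has_integral_is_0) auto
      have "D \<le> D / 2"
        unfolding D_def
      proof (rule dist_bound)
        fix t
        have "norm (Y q t - q) \<le> D / 2"
          using I_diff[of "Y q" "\<lambda>r. q" "c t" D, OF Y_cont continuous_on_const c_in D] Y[of q t] I0[of t] by simp
        then show "dist (apply_bcontfun (Z q) t) (apply_bcontfun (const_bcontfun q) t)
            \<le> dist (Z q) (const_bcontfun q) / 2"
          by (simp add: dist_norm Y_def D_def)
      qed
      with D[of s] norm_ge_zero[of "Y q s - q"] have "norm (Y q s - q) = 0" by linarith
      then show ?thesis by simp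
    qed
  qed
qed

text \<open>\<open>Y \<tau> q\<close> is the solution from \<open>q\<close> under the control \<open>u(t / \<tau>)\<close> on \<open>[0,\<tau>]\<close>, in the time variable
  \<open>s = t / \<tau>\<close>. One bound \<open>\<tau>0\<close> serves all initial points near \<open>p\<close>.\<close>
lemma local_flow:
  fixes f g :: "'a::euclidean_space \<Rightarrow> 'a" and u :: "real \<Rightarrow> real"
  assumes "smooth f" "smooth g" and u: "continuous_on {0..1} u"
  obtains \<tau>0 M Y where "\<tau>0 > 0"
    "\<And>\<tau> q. Y \<tau> q 0 = q"
    "\<And>\<tau> q s. 0 < \<tau> \<Longrightarrow> \<tau> \<le> \<tau>0 \<Longrightarrow> q \<in> cball p (1/2) \<Longrightarrow> s \<in> {0..1} \<Longrightarrow>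
       (Y \<tau> q has_vector_derivative \<tau> *\<^sub>R (f (Y \<tau> q s) + u s *\<^sub>R g (Y \<tau> q s))) (at s within {0..1})"
    "\<And>\<tau> q s. 0 < \<tau> \<Longrightarrow> \<tau> \<le> \<tau>0 \<Longrightarrow> q \<in> cball p (1/2) \<Longrightarrow> s \<in> {0..1} \<Longrightarrow> Y \<tau> q s \<in> cball p 1"
    "\<And>\<tau> q s. 0 < \<tau> \<Longrightarrow> \<tau> \<le> \<tau>0 \<Longrightarrow> s \<in> {0..1} \<Longrightarrow> norm (Y \<tau> q s - q) \<le> \<tau> * M"
    "\<And>\<tau> q q' s. 0 < \<tau> \<Longrightarrow> \<tau> \<le> \<tau>0 \<Longrightarrow> s \<in> {0..1} \<Longrightarrow> norm (Y \<tau> q s - Y \<tau> q' s) \<le> 2 * norm (q - q')"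
    "\<And>\<tau> q s. 0 < \<tau> \<Longrightarrow> \<tau> \<le> \<tau>0 \<Longrightarrow> q \<in> cball p 1 \<Longrightarrow> \<forall>r\<in>{0..1}. f q + u r *\<^sub>R g q = 0 \<Longrightarrow> s \<in> {0..1} \<Longrightarrow> Y \<tau> q s = q"
proof -
  obtain Lf where Lf: "Lf > 0" "\<And>x y. x \<in> cball p 1 \<Longrightarrow> y \<in> cball p 1 \<Longrightarrow> norm (f x - f y) \<le> Lf * norm (x - y)"
    using smooth_lipschitz_on_cball[OF assms(1)] by metis
  obtain Lg where Lg: "Lg > 0" "\<And>x y. x \<in> cball p 1 \<Longrightarrow> y \<in> cball p 1 \<Longrightarrow> norm (g x - g y) \<le> Lg * norm (x - y)"
    using smooth_lipschitz_on_cball[OF assms(2)] by metis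
  have "bounded (u ` {0..1})"
    by (intro compact_imp_bounded compact_continuous_image u) simp
  then obtain C0 where C0: "\<And>s. s \<in> {0..1} \<Longrightarrow> \<bar>u s\<bar> \<le> C0"
    unfolding bounded_iff by fastforce
  define C where "C = max C0 0"
  have C: "C \<ge> 0" "\<And>s. s \<in> {0..1} \<Longrightarrow> \<bar>u s\<bar> \<le> C"
    using C0 by (auto simp: C_def le_max_iff_disj)
  \<comment> \<open>Composing with the projection onto the ball makes the right-hand side globally Lipschitz.\<close>
  define \<pi> where "\<pi> = closest_point (cball p 1)"
  have \<pi>_in: "\<pi> x \<in> cball p 1" for x
    unfolding \<pi>_def by (rule closest_point_in_set) auto
  have \<pi>_id: "x \<in> cball p 1 \<Longrightarrow> \<pi> x = x" for x
    unfolding \<pi>_def by (rule closest_point_self)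
  have \<pi>_lip: "norm (\<pi> x - \<pi> y) \<le> norm (x - y)" for x y
    unfolding \<pi>_def dist_norm[symmetric] by (rule closest_point_lipschitz) auto
  have \<pi>_cont: "continuous_on S \<pi>" for S
    unfolding \<pi>_def by (rule continuous_on_closest_point) auto
  define H where "H s y = f (\<pi> y) + u s *\<^sub>R g (\<pi> y)" for s y
  define L where "L = Lf + C * Lg"
  have L: "L > 0" using Lf(1) Lg(1) C(1) by (simp add: L_def add_pos_nonneg)
  have lip: "norm (H s y - H s z) \<le> L * norm (y - z)" if s: "s \<in> {0..1}" for s y z
  proof -
    have "H s y - H s z = (f (\<pi> y) - f (\<pi> z)) + u s *\<^sub>R (g (\<pi> y) - g (\<pi> z))"
      by (simp add: H_def algebra_simps)
    also have "norm \<dots> \<le> Lf * norm (\<pi> y - \<pi> z) + C * (Lg * norm (\<pi> y - \<pi> z))"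
      using Lf(2)[OF \<pi>_in \<pi>_in] Lg(2)[OF \<pi>_in \<pi>_in] C(1) C(2)[OF s]
      by (intro order_trans[OF norm_triangle_ineq] add_mono) (auto intro!: mult_mono)
    also have "\<dots> = L * norm (\<pi> y - \<pi> z)" by (simp add: L_def algebra_simps)
    also have "\<dots> \<le> L * norm (y - z)" using L \<pi>_lip by (intro mult_left_mono) auto
    finally show ?thesis .
  qed
  define M where "M = norm (f p) + C * norm (g p) + L"
  have M0: "M > 0" using L C(1) by (simp add: M_def add_nonneg_pos)
  have bound: "norm (H s y) \<le> M" if s: "s \<in> {0..1}" for s y
  proof -
    have "norm (H s y) \<le> norm (H s p) + norm (H s y - H s p)" by (metis add.commute norm_triangle_sub)
    moreover have "norm (H s p) \<le> norm (f p) + C * norm (g p)"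
      unfolding H_def using C(2)[OF s] \<pi>_id[of p]
      by (intro order_trans[OF norm_triangle_ineq] add_mono) (auto intro!: mult_mono)
    moreover have "norm (H s y - H s p) \<le> L"
    proof -
      have "H s y - H s p = H s (\<pi> y) - H s p" by (simp add: H_def \<pi>_id[OF \<pi>_in])
      moreover have "norm (\<pi> y - p) \<le> 1" using \<pi>_in[of y] by (simp add: dist_norm norm_minus_commute)
      ultimately show ?thesis
        using lip[OF s, of "\<pi> y" p] L by (smt (verit) mult_left_le)
    qed
    ultimately show ?thesis by (simp add: M_def)
  qed
  define \<tau>0 where "\<tau>0 = min (1 / (2 * L)) (1 / (2 * M))"
  have \<tau>0: "\<tau>0 > 0" using L M0 by (simp add: \<tau>0_def)
  have ex: "\<exists>Y. (\<forall>q. Y q 0 = q) \<and> (0 < \<tau> \<longrightarrow> \<tau> \<le> \<tau>0 \<longrightarrow>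
      (\<forall>q. \<forall>s\<in>{0..1}. (Y q has_vector_derivative \<tau> *\<^sub>R H s (Y q s)) (at s within {0..1}) \<and>
          norm (Y q s - q) \<le> \<tau> * M \<and> (\<forall>q'. norm (Y q s - Y q' s) \<le> 2 * norm (q - q')) \<and>
          ((\<forall>r\<in>{0..1}. H r q = 0) \<longrightarrow> Y q s = q)))" for \<tau>
  proof (cases "0 < \<tau> \<and> \<tau> \<le> \<tau>0")
    case True
    have \<tau>L: "\<tau> * L \<le> 1/2" using True L by (auto simp: \<tau>0_def field_simps)
    obtain Y where P: "\<And>q. Y q 0 = q"
      "\<And>q s. s \<in> {0..1} \<Longrightarrow> (Y q has_vector_derivative \<tau> *\<^sub>R H s (Y q s)) (at s within {0..1})"
      "\<And>q s. s \<in> {0..1} \<Longrightarrow> norm (Y q s - q) \<le> \<tau> * M"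
      "\<And>q q' s. s \<in> {0..1} \<Longrightarrow> norm (Y q s - Y q' s) \<le> 2 * norm (q - q')"
      "\<And>q s. \<forall>r\<in>{0..1}. \<tau> *\<^sub>R H r q = 0 \<Longrightarrow> s \<in> {0..1} \<Longrightarrow> Y q s = q"
    proof (rule picard_unit_interval[of "\<lambda>s y. \<tau> *\<^sub>R H s y" "\<tau> * M"])
      fix y :: "real \<Rightarrow> 'a" assume y: "continuous_on {0..1} y"
      have "continuous_on {0..1} (\<lambda>s. \<pi> (y s))"
        by (rule continuous_on_compose2[OF \<pi>_cont[of UNIV] y]) auto
      then show "continuous_on {0..1} (\<lambda>s. \<tau> *\<^sub>R H s (y s))"
        unfolding H_def
        by (intro continuous_intros u continuous_on_compose2[OF smooth_continuous_on[OF assms(1), of UNIV]]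
            continuous_on_compose2[OF smooth_continuous_on[OF assms(2), of UNIV]]) auto
    next
      show "norm (\<tau> *\<^sub>R H s y) \<le> \<tau> * M" if "s \<in> {0..1}" for s y
        using bound[OF that, of y] True by simp
      show "norm (\<tau> *\<^sub>R H s y - \<tau> *\<^sub>R H s z) \<le> norm (y - z) / 2" if "s \<in> {0..1}" for s y z
      proof -
        have "norm (\<tau> *\<^sub>R H s y - \<tau> *\<^sub>R H s z) = \<tau> * norm (H s y - H s z)"
          using True by (simp add: scaleR_diff_right[symmetric])
        also have "\<dots> \<le> \<tau> * (L * norm (y - z))"
          using lip[OF that, of y z] True by simp
        also have "\<dots> \<le> 1/2 * norm (y - z)"
          unfolding mult.assoc[symmetric] using \<tau>L by (rule mult_right_mono) simp
        finally show ?thesis by simp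
      qed
    qed blast
    have "\<forall>r\<in>{0..1}. H r q = 0 \<Longrightarrow> s \<in> {0..1} \<Longrightarrow> Y q s = q" for q s
      by (rule P(5)) simp_all
    with P(1-4) show ?thesis by (intro exI[of _ Y]) blast
  next
    case False
    show ?thesis by (rule exI[of _ "\<lambda>q s. q"]) (use False in auto)
  qed
  obtain Y where Y: "\<And>\<tau> q. Y \<tau> q 0 = q"
    "\<And>\<tau> q s. 0 < \<tau> \<Longrightarrow> \<tau> \<le> \<tau>0 \<Longrightarrow> s \<in> {0..1} \<Longrightarrow>
       (Y \<tau> q has_vector_derivative \<tau> *\<^sub>R H s (Y \<tau> q s)) (at s within {0..1})"
    "\<And>\<tau> q s. 0 < \<tau> \<Longrightarrow> \<tau> \<le> \<tau>0 \<Longrightarrow> s \<in> {0..1} \<Longrightarrow> norm (Y \<tau> q s - q) \<le> \<tau> * M"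
    "\<And>\<tau> q q' s. 0 < \<tau> \<Longrightarrow> \<tau> \<le> \<tau>0 \<Longrightarrow> s \<in> {0..1} \<Longrightarrow> norm (Y \<tau> q s - Y \<tau> q' s) \<le> 2 * norm (q - q')"
    "\<And>\<tau> q s. 0 < \<tau> \<Longrightarrow> \<tau> \<le> \<tau>0 \<Longrightarrow> \<forall>r\<in>{0..1}. H r q = 0 \<Longrightarrow> s \<in> {0..1} \<Longrightarrow> Y \<tau> q s = q"
  proof -
    from ex obtain Y where Y: "\<And>\<tau>. (\<forall>q. Y \<tau> q 0 = q) \<and> (0 < \<tau> \<longrightarrow> \<tau> \<le> \<tau>0 \<longrightarrow>
      (\<forall>q. \<forall>s\<in>{0..1}. (Y \<tau> q has_vector_derivative \<tau> *\<^sub>R H s (Y \<tau> q s)) (at s within {0..1}) \<and>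
          norm (Y \<tau> q s - q) \<le> \<tau> * M \<and> (\<forall>q'. norm (Y \<tau> q s - Y \<tau> q' s) \<le> 2 * norm (q - q')) \<and>
          ((\<forall>r\<in>{0..1}. H r q = 0) \<longrightarrow> Y \<tau> q s = q)))"
      by metis
    show thesis
      by (rule that[of Y]) (simp_all add: Y)
  qed
  have in_ball: "Y \<tau> q s \<in> cball p 1"
    if "0 < \<tau>" "\<tau> \<le> \<tau>0" "q \<in> cball p (1/2)" "s \<in> {0..1}" for \<tau> q s
  proof -
    have "\<tau> * M \<le> 1/2" using that M0 by (auto simp: \<tau>0_def field_simps)
    then have "dist (Y \<tau> q s) q \<le> 1/2" using Y(3)[OF that(1,2,4), of q] by (simp add: dist_norm)
    then show ?thesis using that(3) dist_triangle[of p "Y \<tau> q s" q] by (simp add: dist_commute)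
  qed
  show thesis
  proof (rule that[of \<tau>0 Y M])
    show "(Y \<tau> q has_vector_derivative \<tau> *\<^sub>R (f (Y \<tau> q s) + u s *\<^sub>R g (Y \<tau> q s))) (at s within {0..1})"
      if "0 < \<tau>" "\<tau> \<le> \<tau>0" "q \<in> cball p (1/2)" "s \<in> {0..1}" for \<tau> q s
      using Y(2)[OF that(1,2,4), of q] \<pi>_id[OF in_ball[OF that]] by (simp add: H_def)
    show "Y \<tau> q s = q" if "0 < \<tau>" "\<tau> \<le> \<tau>0" "q \<in> cball p 1"
      "\<forall>r\<in>{0..1}. f q + u r *\<^sub>R g q = 0" "s \<in> {0..1}" for \<tau> q s
      using Y(5)[OF that(1,2) _ that(5), of q] that(4) \<pi>_id[OF that(3)] by (simp add: H_def)
  qed (use \<tau>0 Y in_ball in auto)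
qed

section \<open>Expansion along rescaled controls\<close>

text \<open>A family of solutions from \<open>p\<close>, indexed by the length \<open>\<tau>\<close> of the time interval, under one control
  profile \<open>u\<close> on \<open>[0,1]\<close>. Keeping the profile fixed while \<open>\<tau>\<close> shrinks makes \<open>V(y \<tau> 1)\<close>
  expand in powers of \<open>\<tau>\<close> with iterated integrals of \<open>u\<close> as coefficients.\<close>
locale scaled_motion =
  fixes f g :: "'a::euclidean_space \<Rightarrow> 'a" and u :: "real \<Rightarrow> real" and p :: 'a
    and y :: "real \<Rightarrow> real \<Rightarrow> 'a" and \<tau>0 :: real
  assumes smooth_f: "smooth f" and smooth_g: "smooth g"
    and u_cont: "continuous_on {0..1} u"
    and start: "y \<tau> 0 = p"
    and motion: "0 < \<tau> \<Longrightarrow> \<tau> \<le> \<tau>0 \<Longrightarrow> s \<in> {0..1} \<Longrightarrow>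
      (y \<tau> has_vector_derivative \<tau> *\<^sub>R (f (y \<tau> s) + u s *\<^sub>R g (y \<tau> s))) (at s within {0..1})"
    and near: "0 < \<tau> \<Longrightarrow> \<tau> \<le> \<tau>0 \<Longrightarrow> s \<in> {0..1} \<Longrightarrow> y \<tau> s \<in> cball p 1"
begin

text \<open>\<open>W(y \<tau> s) = Q \<tau> s + O(\<tau>\<^sup>k)\<close>, uniformly in \<open>s\<close>.\<close>
definition expands :: "nat \<Rightarrow> ('a \<Rightarrow> real) \<Rightarrow> (real \<Rightarrow> real \<Rightarrow> real) \<Rightarrow> bool" where
  "expands k W Q \<longleftrightarrow>
     (\<exists>C. \<forall>\<tau> s. 0 < \<tau> \<longrightarrow> \<tau> \<le> \<tau>0 \<longrightarrow> s \<in> {0..1} \<longrightarrow> \<bar>W (y \<tau> s) - Q \<tau> s\<bar> \<le> C * \<tau> ^ k)"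

lemma expands_0: "smooth W \<Longrightarrow> expands 0 W (\<lambda>\<tau> s. 0)"
proof -
  assume "smooth W"
  then have "bounded (W ` cball p 1)"
    by (intro compact_imp_bounded compact_continuous_image smooth_continuous_on) auto
  then obtain C where "\<And>x. x \<in> cball p 1 \<Longrightarrow> \<bar>W x\<bar> \<le> C"
    unfolding bounded_iff by fastforce
  then show ?thesis
    unfolding expands_def using near by (intro exI[of _ C]) auto
qed

text \<open>The derivative of \<open>s \<mapsto> W(y \<tau> s)\<close> is \<open>\<tau> (fW + u gW)\<close>, so expansions of \<open>fW\<close> and \<open>gW\<close> integrate to an
  expansion of \<open>W\<close> of one order more. Stating the integrated expansion through its derivative
  avoids handling iterated integrals.\<close>
lemma expands_Suc:
  assumes W: "smooth W"
    and f: "expands k (lie_deriv f W) Pf" and g: "expands k (lie_deriv g W) Pg"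
    and Q0: "\<And>\<tau>. Q \<tau> 0 = W p"
    and Q: "\<And>\<tau> s. s \<in> {0..1} \<Longrightarrow> (Q \<tau> has_real_derivative \<tau> * (Pf \<tau> s + u s * Pg \<tau> s)) (at s within {0..1})"
  shows "expands (Suc k) W Q"
proof -
  have "bounded (u ` {0..1})"
    by (intro compact_imp_bounded compact_continuous_image u_cont) simp
  then obtain Cu where Cu: "\<And>s. s \<in> {0..1} \<Longrightarrow> \<bar>u s\<bar> \<le> Cu"
    unfolding bounded_iff by fastforce
  have Cu0: "Cu \<ge> 0" using Cu[of 0] by auto
  obtain Cf where Cf: "\<And>\<tau> s. 0 < \<tau> \<Longrightarrow> \<tau> \<le> \<tau>0 \<Longrightarrow> s \<in> {0..1} \<Longrightarrow> \<bar>lie_deriv f W (y \<tau> s) - Pf \<tau> s\<bar> \<le> Cf * \<tau> ^ k"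
    using f unfolding expands_def by blast
  obtain Cg where Cg: "\<And>\<tau> s. 0 < \<tau> \<Longrightarrow> \<tau> \<le> \<tau>0 \<Longrightarrow> s \<in> {0..1} \<Longrightarrow> \<bar>lie_deriv g W (y \<tau> s) - Pg \<tau> s\<bar> \<le> Cg * \<tau> ^ k"
    using g unfolding expands_def by blast
  have "\<bar>W (y \<tau> s) - Q \<tau> s\<bar> \<le> (Cf + Cu * Cg) * \<tau> ^ Suc k"
    if \<tau>: "0 < \<tau>" "\<tau> \<le> \<tau>0" and s: "s \<in> {0..1}" for \<tau> s
  proof -
    define E where "E s = W (y \<tau> s) - Q \<tau> s" for s
    define E' where "E' s = \<tau> * ((lie_deriv f W (y \<tau> s) - Pf \<tau> s) + u s * (lie_deriv g W (y \<tau> s) - Pg \<tau> s))" for s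
    have dE: "(E has_real_derivative E' s) (at s within {0..1})" if s: "s \<in> {0..1}" for s
    proof -
      interpret D: bounded_linear "frechet_derivative W (at (y \<tau> s))"
        using smooth_has_derivative[OF W] has_derivative_bounded_linear by blast
      have "((\<lambda>s. W (y \<tau> s)) has_vector_derivative frechet_derivative W (at (y \<tau> s))
           (\<tau> *\<^sub>R (f (y \<tau> s) + u s *\<^sub>R g (y \<tau> s)))) (at s within {0..1})"
        using vector_derivative_diff_chain_within[OF motion[OF \<tau> s]
            has_derivative_at_withinI[OF smooth_has_derivative[OF W]]]
        by (simp add: o_def)
      then have "((\<lambda>s. W (y \<tau> s)) has_real_derivative
           \<tau> * (lie_deriv f W (y \<tau> s) + u s * lie_deriv g W (y \<tau> s))) (at s within {0..1})"
        by (simp add: has_real_derivative_iff_has_vector_derivative D.scaleR D.add lie_deriv_def)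
      from DERIV_diff[OF this Q[OF s]] show ?thesis
        unfolding E_def[abs_def] E'_def by (simp add: algebra_simps)
    qed
    have E'_bound: "norm (E' s) \<le> (Cf + Cu * Cg) * \<tau> ^ Suc k" if s: "s \<in> {0..1}" for s
    proof -
      have "\<bar>u s * (lie_deriv g W (y \<tau> s) - Pg \<tau> s)\<bar> \<le> Cu * (Cg * \<tau> ^ k)"
        unfolding abs_mult using Cu[OF s] Cu0 Cg[OF \<tau> s] by (intro mult_mono) auto
      then have "\<bar>(lie_deriv f W (y \<tau> s) - Pf \<tau> s) + u s * (lie_deriv g W (y \<tau> s) - Pg \<tau> s)\<bar>
           \<le> (Cf + Cu * Cg) * \<tau> ^ k"
        using Cf[OF \<tau> s] by (simp add: algebra_simps)
      then show ?thesis
        using \<tau> unfolding E'_def by (simp add: abs_mult mult.left_commute)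
    qed
    have B0: "0 \<le> (Cf + Cu * Cg) * \<tau> ^ Suc k"
      using E'_bound[of 0] norm_ge_zero[of "E' 0"] by simp
    have "norm (E s - E 0) \<le> (Cf + Cu * Cg) * \<tau> ^ Suc k * norm (s - 0)"
      by (rule field_differentiable_bound[of "{0..1}" E E']) (use dE E'_bound s in auto)
    also have "\<dots> \<le> (Cf + Cu * Cg) * \<tau> ^ Suc k"
      using B0 s by (intro mult_left_le) auto
    finally show ?thesis by (simp add: E_def start Q0)
  qed
  then show ?thesis unfolding expands_def by blast
qed

lemma smooth_f_lie: "smooth W \<Longrightarrow> smooth (lie_deriv f W)"
  and smooth_g_lie: "smooth W \<Longrightarrow> smooth (lie_deriv g W)"
  using smooth_f smooth_g smooth_lie_deriv by blast+

lemma expands_1: "smooth W \<Longrightarrow> expands 1 W (\<lambda>\<tau> s. W p)"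
  unfolding One_nat_def
  by (rule expands_Suc[OF _ expands_0 expands_0]) (auto intro!: derivative_eq_intros smooth_f_lie smooth_g_lie)

text \<open>In the next three lemmas \<open>U\<close>, \<open>A\<close>, \<open>B\<close> are the successive primitives of \<open>u\<close>, and \<open>D\<close> is the primitive of
  \<open>U\<^sup>2\<close>. All iterated integrals of \<open>u\<close> that occur reduce to these by partial integration.\<close>
lemma expands_2:
  assumes W: "smooth W"
    and U: "U 0 = 0" "\<And>s. (U has_real_derivative u s) (at s)"
  shows "expands 2 W (\<lambda>\<tau> s. W p + \<tau> * (s * lie_deriv f W p + U s * lie_deriv g W p))"
  unfolding numeral_2_eq_2
  by (rule expands_Suc[OF W expands_1[unfolded One_nat_def] expands_1[unfolded One_nat_def]])
     (auto intro!: derivative_eq_intros smooth_f_lie smooth_g_lie assms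
        DERIV_subset[OF U(2)])

lemma expands_3:
  assumes W: "smooth W"
    and U: "U 0 = 0" "\<And>s. (U has_real_derivative u s) (at s)"
    and A: "A 0 = 0" "\<And>s. (A has_real_derivative U s) (at s)"
  shows "expands 3 W (\<lambda>\<tau> s. W p + \<tau> * (s * lie_deriv f W p + U s * lie_deriv g W p)
      + \<tau>\<^sup>2 * (s\<^sup>2 / 2 * lie_deriv f (lie_deriv f W) p + A s * lie_deriv g (lie_deriv f W) p
             + (s * U s - A s) * lie_deriv f (lie_deriv g W) p + (U s)\<^sup>2 / 2 * lie_deriv g (lie_deriv g W) p))"
  unfolding numeral_3_eq_3
  by (rule expands_Suc[OF W expands_2[OF smooth_f_lie[OF W] U, unfolded numeral_2_eq_2]
          expands_2[OF smooth_g_lie[OF W] U, unfolded numeral_2_eq_2]])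
     (auto simp: U(1) A(1) power2_eq_square algebra_simps
       intro!: derivative_eq_intros DERIV_subset[OF U(2)] DERIV_subset[OF A(2)])

lemma expands_4:
  assumes W: "smooth W"
    and U: "U 0 = 0" "\<And>s. (U has_real_derivative u s) (at s)"
    and A: "A 0 = 0" "\<And>s. (A has_real_derivative U s) (at s)"
    and B: "B 0 = 0" "\<And>s. (B has_real_derivative A s) (at s)"
    and D: "D 0 = 0" "\<And>s. (D has_real_derivative (U s)\<^sup>2) (at s)"
  shows "expands 4 W (\<lambda>\<tau> s. W p + \<tau> * (s * lie_deriv f W p + U s * lie_deriv g W p)
      + \<tau>\<^sup>2 * (s\<^sup>2 / 2 * lie_deriv f (lie_deriv f W) p + A s * lie_deriv g (lie_deriv f W) p
             + (s * U s - A s) * lie_deriv f (lie_deriv g W) p + (U s)\<^sup>2 / 2 * lie_deriv g (lie_deriv g W) p)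
      + \<tau> ^ 3 * (s ^ 3 / 6 * lie_deriv f (lie_deriv f (lie_deriv f W)) p
             + B s * lie_deriv g (lie_deriv f (lie_deriv f W)) p
             + (s * A s - 2 * B s) * lie_deriv f (lie_deriv g (lie_deriv f W)) p
             + D s / 2 * lie_deriv g (lie_deriv g (lie_deriv f W)) p
             + (s\<^sup>2 * U s / 2 - s * A s + B s) * lie_deriv f (lie_deriv f (lie_deriv g W)) p
             + (U s * A s - D s) * lie_deriv g (lie_deriv f (lie_deriv g W)) p
             + (s * (U s)\<^sup>2 / 2 + D s / 2 - U s * A s) * lie_deriv f (lie_deriv g (lie_deriv g W)) p
             + (U s) ^ 3 / 6 * lie_deriv g (lie_deriv g (lie_deriv g W)) p))"
proof -
  have *: "(4::nat) = Suc 3" by simp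
  show ?thesis
    unfolding *
    by (rule expands_Suc[OF W expands_3[OF smooth_f_lie[OF W] U A] expands_3[OF smooth_g_lie[OF W] U A]])
       (auto simp: U(1) A(1) B(1) D(1) power2_eq_square power3_eq_cube field_simps
         intro!: derivative_eq_intros DERIV_subset[OF U(2)] DERIV_subset[OF A(2)]
           DERIV_subset[OF B(2)] DERIV_subset[OF D(2)])
qed

lemma decrease_of_leading_term:
  assumes "expands (Suc k) W Q" and Q: "\<And>\<tau>. Q \<tau> 1 = W p + \<tau> ^ k * \<kappa>" and "\<kappa> < 0"
  shows "\<exists>\<tau>1>0. \<forall>\<tau>. 0 < \<tau> \<and> \<tau> \<le> \<tau>1 \<and> \<tau> \<le> \<tau>0 \<longrightarrow> W (y \<tau> 1) < W p"
proof -
  obtain C where C: "\<And>\<tau> s. 0 < \<tau> \<Longrightarrow> \<tau> \<le> \<tau>0 \<Longrightarrow> s \<in> {0..1} \<Longrightarrow> \<bar>W (y \<tau> s) - Q \<tau> s\<bar> \<le> C * \<tau> ^ Suc k"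
    using assms(1) unfolding expands_def by blast
  define \<tau>1 where "\<tau>1 = - \<kappa> / (2 * (\<bar>C\<bar> + 1))"
  show ?thesis
  proof (intro exI[of _ \<tau>1] conjI allI impI)
    show "\<tau>1 > 0" unfolding \<tau>1_def using assms(3) by (intro divide_pos_pos) auto
    fix \<tau> assume \<tau>: "0 < \<tau> \<and> \<tau> \<le> \<tau>1 \<and> \<tau> \<le> \<tau>0"
    have "C * \<tau> \<le> (\<bar>C\<bar> + 1) * \<tau>1"
      using \<tau> by (intro mult_mono) auto
    also have "\<dots> = - \<kappa> / 2" by (simp add: \<tau>1_def field_simps)
    finally have "C * \<tau> + \<kappa> < 0" using assms(3) by simp
    then have "\<tau> ^ k * (C * \<tau> + \<kappa>) < 0"
      using \<tau> by (intro mult_pos_neg) auto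
    moreover have "\<bar>W (y \<tau> 1) - Q \<tau> 1\<bar> \<le> C * \<tau> ^ Suc k"
      using C[of \<tau> 1] \<tau> by auto
    ultimately show "W (y \<tau> 1) < W p"
      unfolding Q by (simp add: algebra_simps)
  qed
qed

end

text \<open>If \<open>U(1) = 0\<close>, the second-order terms with one factor \<open>g\<close> add up to \<open>- A(1) [f,g]V\<close>. If
  \<open>A(1) = 0\<close> as well, the third-order terms with one factor \<open>g\<close> add up to \<open>B(1) [f,[f,g]]V\<close>, and
  those with two factors to \<open>D(1)/2\<close> times a number \<open>N\<close>; here \<open>B(1)\<close> is linear and \<open>D(1)\<close>
  quadratic in the amplitude of \<open>u\<close>.\<close>
lemma exists_decreasing_control:
  fixes f g :: "'a::euclidean_space \<Rightarrow> 'a" and V :: "'a \<Rightarrow> real"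
  assumes V: "smooth V"
    and smooth: "smooth f" "smooth g"
    and cases: "lie_deriv g V p \<noteq> 0 \<or> lie_deriv f V p < 0 \<or>
      (lie_deriv f V p = 0 \<and> lie_deriv f (lie_deriv f V) p = 0 \<and> lie_deriv f (lie_deriv f (lie_deriv f V)) p = 0 \<and>
       (lie_deriv (lie_bracket f g) V p \<noteq> 0 \<or> lie_deriv (lie_bracket f (lie_bracket f g)) V p \<noteq> 0))"
  shows "\<exists>u. continuous_on {0..1} u \<and>
    (\<forall>y \<tau>0. scaled_motion f g u p y \<tau>0 \<longrightarrow>
      (\<exists>\<tau>1>0. \<forall>\<tau>. 0 < \<tau> \<and> \<tau> \<le> \<tau>1 \<and> \<tau> \<le> \<tau>0 \<longrightarrow> V (y \<tau> 1) < V p))"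
proof -
  consider (first) c where "lie_deriv f V p + c * lie_deriv g V p < 0"
    | (second) "lie_deriv f V p = 0" "lie_deriv g V p = 0" "lie_deriv f (lie_deriv f V) p = 0"
        "lie_deriv (lie_bracket f g) V p \<noteq> 0"
    | (third) "lie_deriv f V p = 0" "lie_deriv g V p = 0" "lie_deriv f (lie_deriv f V) p = 0"
        "lie_deriv (lie_bracket f g) V p = 0"
        "lie_deriv f (lie_deriv f (lie_deriv f V)) p = 0"
        "lie_deriv (lie_bracket f (lie_bracket f g)) V p \<noteq> 0"
  proof -
    have "lie_deriv f V p + (- (\<bar>lie_deriv f V p\<bar> + 1) / lie_deriv g V p) * lie_deriv g V p < 0"
      if "lie_deriv g V p \<noteq> 0"
      using that by simp
    moreover have "lie_deriv f V p + 0 * lie_deriv g V p < 0" if "lie_deriv f V p < 0"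
      using that by simp
    ultimately show thesis using cases first second third by blast
  qed
  then show ?thesis
  proof cases
    case first
    show ?thesis
    proof (intro exI[of _ "\<lambda>s. c"] conjI allI impI)
      fix y \<tau>0 assume "scaled_motion f g (\<lambda>s. c) p y \<tau>0"
      then interpret scaled_motion f g "\<lambda>s. c" p y \<tau>0 .
      show "\<exists>\<tau>1>0. \<forall>\<tau>. 0 < \<tau> \<and> \<tau> \<le> \<tau>1 \<and> \<tau> \<le> \<tau>0 \<longrightarrow> V (y \<tau> 1) < V p"
      proof (rule decrease_of_leading_term[of 1 V _ "lie_deriv f V p + c * lie_deriv g V p"])
        show "expands (Suc 1) V (\<lambda>\<tau> s. V p + \<tau> * (s * lie_deriv f V p + (c * s) * lie_deriv g V p))"
          using expands_2[OF V, of "\<lambda>s. c * s"]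
          by (auto simp: numeral_2_eq_2 intro!: derivative_eq_intros)
      qed (use first in auto)
    qed auto
  next
    case second
    define b where "b = lie_deriv (lie_bracket f g) V p"
    have b: "lie_deriv f (lie_deriv g V) p - lie_deriv g (lie_deriv f V) p = b"
      using lie_deriv_lie_bracket[OF smooth V] by (simp add: b_def)
    have b': "lie_deriv f (lie_deriv g V) p = b + lie_deriv g (lie_deriv f V) p"
      using b by simp
    \<comment> \<open>Mean zero; the amplitude \<open>b\<close> turns the surviving term into \<open>- b\<^sup>2 / 6\<close>.\<close>
    define u where "u s = b * (1 - 2 * s)" for s :: real
    define U where "U s = b * (s - s\<^sup>2)" for s :: real
    define A where "A s = b * (s\<^sup>2 / 2 - s ^ 3 / 3)" for s :: real
    have U: "U 0 = 0" "\<And>s. (U has_real_derivative u s) (at s)"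
      by (auto simp: U_def[abs_def] u_def algebra_simps intro!: derivative_eq_intros)
    have A: "A 0 = 0" "\<And>s. (A has_real_derivative U s) (at s)"
      by (auto simp: U_def A_def[abs_def] algebra_simps intro!: derivative_eq_intros)
    have one: "U 1 = 0" "A 1 = b / 6"
      by (simp_all add: U_def A_def)
    have neg: "- (b * b) / 6 < 0"
      using second(4) by (fold b_def) (metis divide_neg_pos neg_less_0_iff_less not_real_square_gt_zero zero_less_numeral)
    show ?thesis
    proof (intro exI[of _ u] conjI allI impI)
      show "continuous_on {0..1} u" unfolding u_def by (intro continuous_intros)
      fix y \<tau>0 assume "scaled_motion f g u p y \<tau>0"
      then interpret scaled_motion f g u p y \<tau>0 .
      have three: "(3::nat) = Suc 2" by simp
      show "\<exists>\<tau>1>0. \<forall>\<tau>. 0 < \<tau> \<and> \<tau> \<le> \<tau>1 \<and> \<tau> \<le> \<tau>0 \<longrightarrow> V (y \<tau> 1) < V p"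
      proof (rule decrease_of_leading_term[OF expands_3[OF V U A, unfolded three] _ neg])
        fix \<tau> :: real
        show "V p + \<tau> * (1 * lie_deriv f V p + U 1 * lie_deriv g V p)
      + \<tau>\<^sup>2 * (1\<^sup>2 / 2 * lie_deriv f (lie_deriv f V) p + A 1 * lie_deriv g (lie_deriv f V) p
             + (1 * U 1 - A 1) * lie_deriv f (lie_deriv g V) p + (U 1)\<^sup>2 / 2 * lie_deriv g (lie_deriv g V) p)
          = V p + \<tau>\<^sup>2 * (- (b * b) / 6)"
          unfolding one using second(1,2,3)
          by (simp add: b') (simp add: field_simps)
      qed
    qed
  next
    case third
    define K where "K = lie_deriv (lie_bracket f (lie_bracket f g)) V p"
    have K: "lie_deriv f (lie_deriv f (lie_deriv g V)) p - 2 * lie_deriv f (lie_deriv g (lie_deriv f V)) p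
         + lie_deriv g (lie_deriv f (lie_deriv f V)) p = K"
      using lie_deriv_bracket_bracket[OF smooth V] by (simp add: K_def)
    define N where "N = lie_deriv g (lie_deriv g (lie_deriv f V)) p - 2 * lie_deriv g (lie_deriv f (lie_deriv g V)) p
         + lie_deriv f (lie_deriv g (lie_deriv g V)) p"
    \<comment> \<open>Opposite in sign to \<open>K\<close>, and so small that the linear term \<open>c K / 60\<close> dominates \<open>c\<^sup>2 N / 420\<close>.\<close>
    define c where "c = - K / (1 + \<bar>N\<bar>)"
    have fg: "lie_deriv f (lie_deriv g V) p = lie_deriv g (lie_deriv f V) p"
      using lie_deriv_lie_bracket[OF smooth V, of p] third by simp
    \<comment> \<open>A multiple of the quadratic Legendre polynomial on \<open>[0,1]\<close>: its mean and first moment vanish.\<close>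
    define u where "u s = c * (1 - 6 * s + 6 * s\<^sup>2)" for s :: real
    define U where "U s = c * (s - 3 * s\<^sup>2 + 2 * s ^ 3)" for s :: real
    define A where "A s = c * (s\<^sup>2 / 2 - s ^ 3 + s ^ 4 / 2)" for s :: real
    define B where "B s = c * (s ^ 3 / 6 - s ^ 4 / 4 + s ^ 5 / 10)" for s :: real
    define D where "D s = c\<^sup>2 * (s ^ 3 / 3 - 6 * s ^ 4 / 4 + 13 * s ^ 5 / 5 - 2 * s ^ 6 + 4 * s ^ 7 / 7)" for s :: real
    have U: "U 0 = 0" "\<And>s. (U has_real_derivative u s) (at s)"
      by (auto simp: U_def[abs_def] u_def power2_eq_square algebra_simps intro!: derivative_eq_intros)
    have A: "A 0 = 0" "\<And>s. (A has_real_derivative U s) (at s)"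
      by (auto simp: U_def A_def[abs_def] power2_eq_square power3_eq_cube algebra_simps intro!: derivative_eq_intros)
    have B: "B 0 = 0" "\<And>s. (B has_real_derivative A s) (at s)"
      by (auto simp: B_def[abs_def] A_def algebra_simps intro!: derivative_eq_intros)
    have D0: "D 0 = 0" by (simp add: D_def)
    have D': "(D has_real_derivative (U s)\<^sup>2) (at s)" for s
    proof -
      have "(D has_real_derivative c\<^sup>2 * (s\<^sup>2 - 6 * s ^ 3 + 13 * s ^ 4 - 12 * s ^ 5 + 4 * s ^ 6)) (at s)"
        unfolding D_def[abs_def] by (auto intro!: derivative_eq_intros simp: algebra_simps)
      also have "c\<^sup>2 * (s\<^sup>2 - 6 * s ^ 3 + 13 * s ^ 4 - 12 * s ^ 5 + 4 * s ^ 6) = (U s)\<^sup>2"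
        unfolding U_def by algebra
      finally show ?thesis .
    qed
    have one: "U 1 = 0" "A 1 = 0" "B 1 = c / 60" "D 1 = c\<^sup>2 / 210"
      by (simp_all add: U_def A_def B_def D_def)
    have neg: "c / 60 * K + c\<^sup>2 / 420 * N < 0"
    proof -
      have N1: "1 + \<bar>N\<bar> > 0" by simp
      have "c / 60 * K + c\<^sup>2 / 420 * N = (K / (1 + \<bar>N\<bar>))\<^sup>2 * (N - 7 * (1 + \<bar>N\<bar>)) / 420"
        using N1 by (simp add: c_def power2_eq_square divide_simps) (simp add: algebra_simps)
      moreover have "(K / (1 + \<bar>N\<bar>))\<^sup>2 > 0" using third by (simp add: K_def)
      moreover have "N - 7 * (1 + \<bar>N\<bar>) < 0"
        using abs_ge_self[of N] abs_ge_zero[of N] unfolding distrib_left by linarith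
      ultimately show ?thesis using mult_pos_neg by (metis divide_neg_pos zero_less_numeral)
    qed
    show ?thesis
    proof (intro exI[of _ u] conjI allI impI)
      show "continuous_on {0..1} u" unfolding u_def by (intro continuous_intros)
      fix y \<tau>0 assume "scaled_motion f g u p y \<tau>0"
      then interpret scaled_motion f g u p y \<tau>0 .
      have four: "(4::nat) = Suc 3" by simp
      show "\<exists>\<tau>1>0. \<forall>\<tau>. 0 < \<tau> \<and> \<tau> \<le> \<tau>1 \<and> \<tau> \<le> \<tau>0 \<longrightarrow> V (y \<tau> 1) < V p"
      proof (rule decrease_of_leading_term[OF expands_4[OF V U A B D0 D', unfolded four] _ neg])
        fix \<tau> :: real
        show "V p + \<tau> * (1 * lie_deriv f V p + U 1 * lie_deriv g V p)
      + \<tau>\<^sup>2 * (1\<^sup>2 / 2 * lie_deriv f (lie_deriv f V) p + A 1 * lie_deriv g (lie_deriv f V) p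
             + (1 * U 1 - A 1) * lie_deriv f (lie_deriv g V) p + (U 1)\<^sup>2 / 2 * lie_deriv g (lie_deriv g V) p)
      + \<tau> ^ 3 * (1 ^ 3 / 6 * lie_deriv f (lie_deriv f (lie_deriv f V)) p
             + B 1 * lie_deriv g (lie_deriv f (lie_deriv f V)) p
             + (1 * A 1 - 2 * B 1) * lie_deriv f (lie_deriv g (lie_deriv f V)) p
             + D 1 / 2 * lie_deriv g (lie_deriv g (lie_deriv f V)) p
             + (1\<^sup>2 * U 1 / 2 - 1 * A 1 + B 1) * lie_deriv f (lie_deriv f (lie_deriv g V)) p
             + (U 1 * A 1 - D 1) * lie_deriv g (lie_deriv f (lie_deriv g V)) p
             + (1 * (U 1)\<^sup>2 / 2 + D 1 / 2 - U 1 * A 1) * lie_deriv f (lie_deriv g (lie_deriv g V)) p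
             + (U 1) ^ 3 / 6 * lie_deriv g (lie_deriv g (lie_deriv g V)) p)
          = V p + \<tau> ^ 3 * (c / 60 * K + c\<^sup>2 / 420 * N)"
          unfolding one using third(1,2,3,5) fg
          by (simp add: K[symmetric] N_def) (simp add: field_simps)
      qed
    qed
  qed
qed

section \<open>Steering\<close>

text \<open>Finitely many exceptional times admit concatenation of motions; with continuity of \<open>x\<close> they do
  not affect the fundamental theorem of calculus.\<close>
definition controlled_motion ::
  "('a::euclidean_space \<Rightarrow> 'a) \<Rightarrow> ('a \<Rightarrow> 'a) \<Rightarrow> (real \<Rightarrow> real) \<Rightarrow> (real \<Rightarrow> 'a) \<Rightarrow> real \<Rightarrow> bool" where
  "controlled_motion f g u x \<tau> \<longleftrightarrow>
     continuous_on {0..\<tau>} x \<and> u \<in> borel_measurable borel \<and> bounded (range u) \<and>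
     (\<exists>S. finite S \<and> (\<forall>t\<in>{0<..<\<tau>} - S. (x has_vector_derivative f (x t) + u t *\<^sub>R g (x t)) (at t)))"

text \<open>Steering always starts at time 0, which is no restriction as the system is autonomous.\<close>
definition steers ::
  "('a::euclidean_space \<Rightarrow> 'a) \<Rightarrow> ('a \<Rightarrow> 'a) \<Rightarrow> 'a set \<Rightarrow> 'a \<Rightarrow> 'a \<Rightarrow> real \<Rightarrow> bool" where
  "steers f g C q y \<tau> \<longleftrightarrow> 0 \<le> \<tau> \<and>
     (\<exists>u x. controlled_motion f g u x \<tau> \<and> x 0 = q \<and> x \<tau> = y \<and> x ` {0..\<tau>} \<subseteq> C)"

lemma controlled_motion_const: "f q = 0 \<Longrightarrow> controlled_motion f g (\<lambda>t. 0) (\<lambda>t. q) \<tau>"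
  unfolding controlled_motion_def
  by (intro conjI exI[where x="{}"]) (auto intro!: derivative_eq_intros)

lemma steers_refl: "q \<in> C \<Longrightarrow> steers f g C q q 0"
  unfolding steers_def controlled_motion_def
  by (intro conjI exI[where x="\<lambda>t. 0"] exI[where x="\<lambda>t. q"] exI[where x="{}"]) auto

lemma steers_mono: "steers f g C q y \<tau> \<Longrightarrow> C \<subseteq> C' \<Longrightarrow> steers f g C' q y \<tau>"
  unfolding steers_def by blast

lemma steers_start_end: "steers f g C q y \<tau> \<Longrightarrow> q \<in> C \<and> y \<in> C"
  unfolding steers_def by (auto simp: image_subset_iff)

lemma has_vector_derivative_shift:
  fixes x :: "real \<Rightarrow> 'a::real_normed_vector"
  assumes "(x has_vector_derivative d) (at (t + c))"
  shows "((\<lambda>s. x (s + c)) has_vector_derivative d) (at t)"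
proof -
  have "((\<lambda>s. s + c) has_vector_derivative 1) (at t)"
    by (auto intro!: derivative_eq_intros)
  from vector_diff_chain_at[OF this, of x d] assms show ?thesis
    by (simp add: o_def)
qed

lemma steers_trans:
  assumes "steers f g C q y \<tau>" "steers f g C y z \<sigma>"
  shows "steers f g C q z (\<tau> + \<sigma>)"
proof -
  obtain u1 x1 S1 where 1: "0 \<le> \<tau>" "continuous_on {0..\<tau>} x1" "u1 \<in> borel_measurable borel" "bounded (range u1)"
    "finite S1" "\<And>t. t \<in> {0<..<\<tau>} - S1 \<Longrightarrow> (x1 has_vector_derivative f (x1 t) + u1 t *\<^sub>R g (x1 t)) (at t)"
    "x1 0 = q" "x1 \<tau> = y" "x1 ` {0..\<tau>} \<subseteq> C"
    using assms(1) unfolding steers_def controlled_motion_def by blast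
  obtain u2 x2 S2 where 2: "0 \<le> \<sigma>" "continuous_on {0..\<sigma>} x2" "u2 \<in> borel_measurable borel" "bounded (range u2)"
    "finite S2" "\<And>t. t \<in> {0<..<\<sigma>} - S2 \<Longrightarrow> (x2 has_vector_derivative f (x2 t) + u2 t *\<^sub>R g (x2 t)) (at t)"
    "x2 0 = y" "x2 \<sigma> = z" "x2 ` {0..\<sigma>} \<subseteq> C"
    using assms(2) unfolding steers_def controlled_motion_def by blast
  define x where "x t = (if t \<le> \<tau> then x1 t else x2 (t - \<tau>))" for t
  define u where "u t = (if t \<le> \<tau> then u1 t else u2 (t - \<tau>))" for t
  define S where "S = S1 \<union> {\<tau>} \<union> (\<lambda>t. t + \<tau>) ` S2"
  have "continuous_on ({0..\<tau>} \<union> {\<tau>..\<tau> + \<sigma>}) x"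
    unfolding x_def
  proof (rule continuous_on_cases)
    show "continuous_on {\<tau>..\<tau> + \<sigma>} (\<lambda>t. x2 (t - \<tau>))"
      by (rule continuous_on_compose2[OF 2(2)]) (auto intro!: continuous_intros)
  qed (use 1 2 in auto)
  moreover have "{0..\<tau>} \<union> {\<tau>..\<tau> + \<sigma>} = {0..\<tau> + \<sigma>}"
    using 1(1) 2(1) by auto
  ultimately have "continuous_on {0..\<tau> + \<sigma>} x" by simp
  moreover have "u \<in> borel_measurable borel"
    unfolding u_def using 1(3) 2(3) by measurable
  moreover have "bounded (range u)"
    by (rule bounded_subset[OF bounded_Un[THEN iffD2, OF conjI[OF 1(4) 2(4)]]]) (auto simp: u_def)
  moreover have "(x has_vector_derivative f (x t) + u t *\<^sub>R g (x t)) (at t)"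
    if t: "t \<in> {0<..<\<tau> + \<sigma>} - S" for t
  proof (cases "t < \<tau>")
    case True
    have "(x1 has_vector_derivative f (x t) + u t *\<^sub>R g (x t)) (at t)"
      using 1(6)[of t] t True by (simp add: x_def u_def S_def)
    then show ?thesis
      by (rule has_vector_derivative_transform_within_open[of _ _ _ "{..<\<tau>}"])
         (use True in \<open>auto simp: x_def\<close>)
  next
    case False
    then have t\<tau>: "\<tau> < t" using t by (auto simp: S_def)
    have "t - \<tau> \<notin> S2"
    proof
      assume "t - \<tau> \<in> S2"
      then have "(t - \<tau>) + \<tau> \<in> S" unfolding S_def by blast
      then show False using t by simp
    qed
    then have "(x2 has_vector_derivative f (x t) + u t *\<^sub>R g (x t)) (at (t + - \<tau>))"
      using 2(6)[of "t - \<tau>"] t t\<tau> by (simp add: x_def u_def)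
    from has_vector_derivative_shift[OF this] show ?thesis
      by (rule has_vector_derivative_transform_within_open[of _ _ _ "{\<tau><..}"])
         (use t\<tau> in \<open>auto simp: x_def\<close>)
  qed
  moreover have "finite S" using 1(5) 2(5) by (simp add: S_def)
  ultimately have "controlled_motion f g u x (\<tau> + \<sigma>)"
    unfolding controlled_motion_def by blast
  moreover have "x 0 = q" using 1(1,7) by (simp add: x_def)
  moreover have "x (\<tau> + \<sigma>) = z"
    using 1(8) 2(1,7,8) by (cases "\<sigma> = 0") (simp_all add: x_def)
  moreover have "x ` {0..\<tau> + \<sigma>} \<subseteq> C"
    using 1(9) 2(9) by (auto simp: x_def image_subset_iff)
  moreover have "0 \<le> \<tau> + \<sigma>" using 1(1) 2(1) by simp
  ultimately show ?thesis
    unfolding steers_def by blast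
qed

lemma controlled_motion_head:
  assumes "controlled_motion f g u x \<tau>" "\<sigma> \<le> \<tau>"
  shows "controlled_motion f g u x \<sigma>"
proof -
  obtain S where "finite S" "\<forall>t\<in>{0<..<\<tau>} - S. (x has_vector_derivative f (x t) + u t *\<^sub>R g (x t)) (at t)"
    using assms(1) unfolding controlled_motion_def by blast
  then show ?thesis
    using assms unfolding controlled_motion_def
    by (auto intro!: exI[of _ S] elim: continuous_on_subset)
qed

lemma controlled_motion_tail:
  assumes "controlled_motion f g u x \<tau>" "0 \<le> \<sigma>" "\<sigma> \<le> \<tau>"
  shows "controlled_motion f g (\<lambda>t. u (t + \<sigma>)) (\<lambda>t. x (t + \<sigma>)) (\<tau> - \<sigma>)"
proof -
  obtain S where S: "finite S" "\<forall>t\<in>{0<..<\<tau>} - S. (x has_vector_derivative f (x t) + u t *\<^sub>R g (x t)) (at t)"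
    and u[measurable]: "u \<in> borel_measurable borel"
    using assms(1) unfolding controlled_motion_def by blast
  have "((\<lambda>t. x (t + \<sigma>)) has_vector_derivative f (x (t + \<sigma>)) + u (t + \<sigma>) *\<^sub>R g (x (t + \<sigma>))) (at t)"
    if t: "t \<in> {0<..<\<tau> - \<sigma>} - (\<lambda>s. s - \<sigma>) ` S" for t
  proof (rule has_vector_derivative_shift)
    have "t + \<sigma> \<notin> S"
    proof
      assume "t + \<sigma> \<in> S"
      then have "(t + \<sigma>) - \<sigma> \<in> (\<lambda>s. s - \<sigma>) ` S" by (rule imageI)
      then show False using t by simp
    qed
    then show "(x has_vector_derivative f (x (t + \<sigma>)) + u (t + \<sigma>) *\<^sub>R g (x (t + \<sigma>))) (at (t + \<sigma>))"
      using S(2) t assms(2) by auto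
  qed
  moreover have "continuous_on {0..\<tau> - \<sigma>} (\<lambda>t. x (t + \<sigma>))"
  proof -
    have "continuous_on {0..\<tau>} x" using assms(1) by (simp add: controlled_motion_def)
    then show ?thesis
      by (rule continuous_on_compose2) (use assms(2) in \<open>auto intro!: continuous_intros\<close>)
  qed
  moreover have "bounded (range (\<lambda>t. u (t + \<sigma>)))"
    using assms(1) by (auto simp: controlled_motion_def intro: bounded_subset)
  moreover have "(\<lambda>t. u (t + \<sigma>)) \<in> borel_measurable borel" by measurable
  ultimately show ?thesis
    unfolding controlled_motion_def using S(1) by blast
qed

lemma steers_split:
  assumes "steers f g C q y \<tau>" "0 \<le> \<sigma>" "\<sigma> \<le> \<tau>"
  obtains u x where "controlled_motion f g u x \<sigma>" "x 0 = q" "x ` {0..\<sigma>} \<subseteq> C"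
    "steers f g C (x \<sigma>) y (\<tau> - \<sigma>)"
proof -
  obtain u x where x: "controlled_motion f g u x \<tau>" "x 0 = q" "x \<tau> = y" "x ` {0..\<tau>} \<subseteq> C"
    using assms(1) unfolding steers_def by blast
  have "steers f g C (x \<sigma>) y (\<tau> - \<sigma>)"
    unfolding steers_def using controlled_motion_tail[OF x(1) assms(2,3)] x assms(2,3)
    by (intro conjI exI[of _ "\<lambda>t. u (t + \<sigma>)"] exI[of _ "\<lambda>t. x (t + \<sigma>)"])
       (auto simp: image_subset_iff)
  moreover have "x ` {0..\<sigma>} \<subseteq> C" using x(4) assms by auto
  ultimately show thesis
    using that controlled_motion_head[OF x(1) assms(3)] x(2) by blast
qed

lemma steers_truncate:
  assumes "steers f g C q y \<tau>" "0 \<le> \<sigma>" "\<sigma> \<le> \<tau>"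
  obtains z where "steers f g C q z \<sigma>"
proof -
  obtain u x where "controlled_motion f g u x \<sigma>" "x 0 = q" "x ` {0..\<sigma>} \<subseteq> C"
    by (rule steers_split[OF assms])
  then have "steers f g C q (x \<sigma>) \<sigma>"
    unfolding steers_def using assms(2) by blast
  then show thesis by (rule that)
qed

lemma steers_rescaled:
  fixes f g :: "'a::euclidean_space \<Rightarrow> 'a" and u :: "real \<Rightarrow> real"
  assumes \<tau>: "\<tau> > 0" and u: "continuous_on {0..1} u"
    and y: "\<And>s. s \<in> {0..1} \<Longrightarrow>
      (y has_vector_derivative \<tau> *\<^sub>R (f (y s) + u s *\<^sub>R g (y s))) (at s within {0..1})"
    and C: "y ` {0..1} \<subseteq> C"
  shows "steers f g C (y 0) (y 1) \<tau>"
proof -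
  define v where "v t = indicator {0..\<tau>} t *\<^sub>R u (t / \<tau>)" for t
  have "continuous_on {0..\<tau>} (\<lambda>t. u (t / \<tau>))"
    by (rule continuous_on_compose2[OF u]) (use \<tau> in \<open>auto intro!: continuous_intros\<close>)
  then have v1: "v \<in> borel_measurable borel" unfolding v_def
    by (intro borel_measurable_continuous_on_indicator) auto
  have "bounded (u ` {0..1})"
    by (intro compact_imp_bounded compact_continuous_image u) simp
  then have "bounded (insert 0 (u ` {0..1}))" by simp
  then have v2: "bounded (range v)"
    by (rule bounded_subset) (use \<tau> in \<open>auto simp: v_def indicator_def\<close>)
  have y_cont: "continuous_on {0..1} y"
    unfolding continuous_on_eq_continuous_within
    using y has_vector_derivative_continuous by blast
  have x1: "continuous_on {0..\<tau>} (\<lambda>t. y (t / \<tau>))"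
    by (rule continuous_on_compose2[OF y_cont]) (use \<tau> in \<open>auto intro!: continuous_intros\<close>)
  have x2: "((\<lambda>t. y (t / \<tau>)) has_vector_derivative f (y (t / \<tau>)) + v t *\<^sub>R g (y (t / \<tau>))) (at t)"
    if t: "t \<in> {0<..<\<tau>}" for t
  proof -
    have s: "t / \<tau> \<in> {0<..<1}" using t \<tau> by auto
    have "(y has_vector_derivative \<tau> *\<^sub>R (f (y (t / \<tau>)) + u (t / \<tau>) *\<^sub>R g (y (t / \<tau>)))) (at (t / \<tau>))"
    proof -
      have "at (t / \<tau>) within {0..1} = at (t / \<tau>)"
        using s by (intro at_within_interior) (auto simp: interior_atLeastAtMost_real)
      then show ?thesis using y[of "t / \<tau>"] s by auto
    qed
    moreover have "((\<lambda>t. t / \<tau>) has_vector_derivative 1 / \<tau>) (at t)"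
      unfolding has_real_derivative_iff_has_vector_derivative[symmetric]
      using \<tau> by (auto intro!: derivative_eq_intros)
    ultimately have "((y \<circ> (\<lambda>t. t / \<tau>)) has_vector_derivative
        (1 / \<tau>) *\<^sub>R (\<tau> *\<^sub>R (f (y (t / \<tau>)) + u (t / \<tau>) *\<^sub>R g (y (t / \<tau>))))) (at t)"
      by (intro vector_diff_chain_at)
    moreover have "v t = u (t / \<tau>)" using t by (simp add: v_def)
    ultimately show ?thesis using \<tau> by (simp add: o_def)
  qed
  have "controlled_motion f g v (\<lambda>t. y (t / \<tau>)) \<tau>"
    unfolding controlled_motion_def
    by (intro conjI x1 v1 v2 exI[of _ "{}"]) (use x2 in auto)
  moreover have "(\<lambda>t. y (t / \<tau>)) ` {0..\<tau>} \<subseteq> C"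
    using C \<tau> by (auto simp: image_subset_iff)
  ultimately show ?thesis
    unfolding steers_def using \<tau>
    by (intro conjI exI[of _ v] exI[of _ "\<lambda>t. y (t / \<tau>)"]) simp_all
qed

section \<open>Descent of the Lyapunov function\<close>

text \<open>A control that decreases \<open>V\<close> from \<open>p\<close> by \<open>4 d\<close>, applied from a point \<open>q\<close> so close to \<open>p\<close> that \<open>V\<close> differs by at
  most \<open>e \<le> d\<close> between the two paths, still decreases it by \<open>d\<close>. The time \<open>\<tau>\<close> is chosen so short that
  \<open>V \<le> 3/2 V(p)\<close> along the path from \<open>p\<close>, which leaves room for the bound \<open>2 V(q)\<close>.\<close>
lemma local_descent:
  fixes f g :: "'a::euclidean_space \<Rightarrow> 'a" and V :: "'a \<Rightarrow> real"
  assumes smooth: "smooth f" "smooth g" and V: "smooth V" and Vp: "V p > 0"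
    and u: "continuous_on {0..1} u"
    and decr: "\<And>y \<tau>0. scaled_motion f g u p y \<tau>0 \<Longrightarrow>
      \<exists>\<tau>1>0. \<forall>\<tau>. 0 < \<tau> \<and> \<tau> \<le> \<tau>1 \<and> \<tau> \<le> \<tau>0 \<longrightarrow> V (y \<tau> 1) < V p"
  shows "\<exists>r>0. \<exists>d>0. \<forall>q\<in>ball p r. \<exists>y \<tau>. steers f g {z. V z \<le> 2 * V q} q y \<tau> \<and> V y \<le> V q - d"
proof -
  obtain \<tau>0 Y M where \<tau>0: "\<tau>0 > 0"
    and Y0: "\<And>\<tau> q. Y \<tau> q 0 = q"
    and dY: "\<And>\<tau> q s. 0 < \<tau> \<Longrightarrow> \<tau> \<le> \<tau>0 \<Longrightarrow> q \<in> cball p (1/2) \<Longrightarrow> s \<in> {0..1} \<Longrightarrow>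
       (Y \<tau> q has_vector_derivative \<tau> *\<^sub>R (f (Y \<tau> q s) + u s *\<^sub>R g (Y \<tau> q s))) (at s within {0..1})"
    and inY: "\<And>\<tau> q s. 0 < \<tau> \<Longrightarrow> \<tau> \<le> \<tau>0 \<Longrightarrow> q \<in> cball p (1/2) \<Longrightarrow> s \<in> {0..1} \<Longrightarrow> Y \<tau> q s \<in> cball p 1"
    and YM: "\<And>\<tau> q s. 0 < \<tau> \<Longrightarrow> \<tau> \<le> \<tau>0 \<Longrightarrow> s \<in> {0..1} \<Longrightarrow> norm (Y \<tau> q s - q) \<le> \<tau> * M"
    and YL: "\<And>\<tau> q q' s. 0 < \<tau> \<Longrightarrow> \<tau> \<le> \<tau>0 \<Longrightarrow> s \<in> {0..1} \<Longrightarrow> norm (Y \<tau> q s - Y \<tau> q' s) \<le> 2 * norm (q - q')"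
    and "\<And>\<tau> q s. 0 < \<tau> \<Longrightarrow> \<tau> \<le> \<tau>0 \<Longrightarrow> q \<in> cball p 1 \<Longrightarrow> \<forall>r\<in>{0..1}. f q + u r *\<^sub>R g q = 0 \<Longrightarrow>
       s \<in> {0..1} \<Longrightarrow> Y \<tau> q s = q"
  proof (rule local_flow[OF smooth u, of p], goal_cases)
    case prems: (1 \<tau>0 M Y)
    show ?case
      by (rule that[of \<tau>0 Y M]) (rule prems; assumption)+
  qed
  have "scaled_motion f g u p (\<lambda>\<tau>. Y \<tau> p) \<tau>0"
    by unfold_locales (use smooth u Y0 dY inY in auto)
  then obtain \<tau>1 where \<tau>1: "\<tau>1 > 0" "\<And>\<tau>. 0 < \<tau> \<Longrightarrow> \<tau> \<le> \<tau>1 \<Longrightarrow> \<tau> \<le> \<tau>0 \<Longrightarrow> V (Y \<tau> p 1) < V p"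
    using decr by blast
  obtain L where L: "L > 0" "\<And>x y. x \<in> cball p 1 \<Longrightarrow> y \<in> cball p 1 \<Longrightarrow> norm (V x - V y) \<le> L * norm (x - y)"
    using smooth_lipschitz_on_cball[OF V] by metis
  define \<tau> where "\<tau> = min (min \<tau>0 \<tau>1) (V p / (2 * L * (\<bar>M\<bar> + 1)))"
  have \<tau>: "0 < \<tau>" "\<tau> \<le> \<tau>0" "\<tau> \<le> \<tau>1"
    using \<tau>0 \<tau>1(1) Vp L(1) by (auto simp: \<tau>_def)
  have small: "L * (\<tau> * M) \<le> V p / 2"
  proof -
    have "\<tau> * M \<le> (V p / (2 * L * (\<bar>M\<bar> + 1))) * (\<bar>M\<bar> + 1)"
    proof -
      have "\<tau> * M \<le> \<tau> * (\<bar>M\<bar> + 1)" using \<tau>(1) by (intro mult_left_mono) auto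
      also have "\<dots> \<le> (V p / (2 * L * (\<bar>M\<bar> + 1))) * (\<bar>M\<bar> + 1)"
        by (intro mult_right_mono) (auto simp: \<tau>_def)
      finally show ?thesis .
    qed
    also have "\<dots> = V p / (2 * L)"
    proof -
      have "\<bar>M\<bar> + 1 \<noteq> 0" using abs_ge_zero[of M] by linarith
      then show ?thesis using L(1) by (simp add: divide_simps)
    qed
    finally show ?thesis using L(1) by (simp add: field_simps)
  qed
  define d where "d = (V p - V (Y \<tau> p 1)) / 4"
  have d: "d > 0" using \<tau>1(2)[OF \<tau>(1,3,2)] by (simp add: d_def)
  define e where "e = min d (V p / 8)"
  have e: "e > 0" "e \<le> d" "e \<le> V p / 8" using d Vp by (auto simp: e_def)
  define r where "r = min (1/2) (e / (2 * L))"
  have r: "r > 0" "r \<le> 1/2" "2 * L * r \<le> e"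
    using e(1) L(1) by (auto simp: r_def min_def field_simps)
  have p: "p \<in> cball p 1" "p \<in> cball p (1/2)" by auto
  have "\<exists>y \<sigma>. steers f g {z. V z \<le> 2 * V q} q y \<sigma> \<and> V y \<le> V q - d" if q: "q \<in> ball p r" for q
  proof -
    have qp: "norm (q - p) \<le> r" using q by (auto simp: dist_norm norm_minus_commute)
    have q2: "q \<in> cball p (1/2)" "q \<in> cball p 1" using q r(2) by auto
    have Lr: "L * (2 * norm (q - p)) \<le> e"
    proof -
      have "L * (2 * norm (q - p)) = 2 * L * norm (q - p)" by simp
      also have "\<dots> \<le> 2 * L * r" using L(1) qp by (intro mult_left_mono) auto
      finally show ?thesis using r(3) by linarith
    qed
    have Vq: "\<bar>V q - V p\<bar> \<le> e"
      using L(2)[OF q2(2) p(1)] Lr L(1) mult_nonneg_nonneg[of L "norm (q - p)"] by simp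
    have near: "\<bar>V (Y \<tau> q s) - V (Y \<tau> p s)\<bar> \<le> e" if s: "s \<in> {0..1}" for s
      using L(2)[OF inY[OF \<tau>(1,2) q2(1) s] inY[OF \<tau>(1,2) p(2) s]] Lr
        mult_left_mono[OF YL[OF \<tau>(1,2) s, of q p] less_imp_le[OF L(1)]] by simp
    have path: "V (Y \<tau> q s) \<le> 2 * V q" if s: "s \<in> {0..1}" for s
    proof -
      have "\<bar>V (Y \<tau> p s) - V p\<bar> \<le> V p / 2"
        using L(2)[OF inY[OF \<tau>(1,2) p(2) s] p(1)] small
          mult_left_mono[OF YM[OF \<tau>(1,2) s, of p] less_imp_le[OF L(1)]] by simp
      then show ?thesis using near[OF s] Vq e(3) by linarith
    qed
    have "steers f g {z. V z \<le> 2 * V q} (Y \<tau> q 0) (Y \<tau> q 1) \<tau>"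
      by (rule steers_rescaled[OF \<tau>(1) u dY[OF \<tau>(1,2) q2(1)]]) (use path in auto)
    moreover have "V (Y \<tau> q 1) \<le> V q - d"
    proof -
      have "V (Y \<tau> p 1) = V p - 4 * d" by (simp add: d_def field_simps)
      moreover have "\<bar>V (Y \<tau> q 1) - V (Y \<tau> p 1)\<bar> \<le> e" by (rule near) simp
      ultimately show ?thesis using Vq e(2) d unfolding abs_le_iff by linarith
    qed
    ultimately show ?thesis unfolding Y0 by blast
  qed
  then show ?thesis using r(1) d by blast
qed

text \<open>What the global construction uses of the system: the decrease \<open>d\<close> is uniform near \<open>p\<close>, whereas the time
  that it takes is not bounded in any way.\<close>
locale steerable_lyapunov =
  fixes f g :: "'a::euclidean_space \<Rightarrow> 'a" and V :: "'a \<Rightarrow> real"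
  assumes smooth_f: "smooth f" and smooth_g: "smooth g" and f0: "f 0 = 0"
    and V_cont: "continuous_on UNIV V"
    and V0: "V 0 = 0" and V_pos: "x \<noteq> 0 \<Longrightarrow> V x > 0"
    and sublevel_compact: "compact {z. V z \<le> b}"
    and descent: "p \<noteq> 0 \<Longrightarrow> \<exists>r>0. \<exists>d>0. \<forall>q\<in>ball p r. \<exists>y \<tau>.
      steers f g {z. V z \<le> 2 * V q} q y \<tau> \<and> V y \<le> V q - d"
begin

lemma V_nonneg: "V x \<ge> 0"
  using V_pos[of x] V0 by (cases "x = 0") auto

lemma small_norm_small_V:
  assumes "b > 0"
  obtains \<delta> where "\<delta> > 0" "\<And>z. norm z \<le> \<delta> \<Longrightarrow> V z \<le> b"
proof -
  have "isCont V 0" using V_cont by (simp add: continuous_on_eq_continuous_at)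
  then obtain d where d: "d > 0" "\<And>z. dist z 0 < d \<Longrightarrow> dist (V z) (V 0) < b"
    using assms unfolding continuous_at_eps_delta by metis
  show thesis
  proof (rule that[of "d / 2"])
    show "V z \<le> b" if "norm z \<le> d / 2" for z
      using d(2)[of z] d(1) that by (simp add: V0 dist_real_def)
  qed (use d(1) in simp)
qed

lemma small_V_small_norm:
  assumes "\<epsilon> > 0"
  obtains a where "a > 0" "\<And>z. V z \<le> a \<Longrightarrow> norm z < \<epsilon>"
proof -
  define K where "K = {z. V z \<le> 1} \<inter> - ball 0 \<epsilon>"
  have K: "compact K"
    unfolding K_def by (intro compact_Int_closed sublevel_compact) (simp add: closed_Compl)
  show thesis
  proof (cases "K = {}")
    case True
    show thesis by (rule that[of 1]) (use True in \<open>auto simp: K_def\<close>)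
  next
    case False
    obtain k where k: "k \<in> K" "\<And>z. z \<in> K \<Longrightarrow> V k \<le> V z"
      using continuous_attains_inf[OF K False continuous_on_subset[OF V_cont]] by auto
    have "k \<noteq> 0" using k(1) assms by (auto simp: K_def)
    then have Vk: "V k > 0" by (rule V_pos)
    show thesis
    proof (rule that[of "min 1 (V k / 2)"])
      show "norm z < \<epsilon>" if z: "V z \<le> min 1 (V k / 2)" for z
      proof (rule ccontr)
        assume "\<not> norm z < \<epsilon>"
        then have "z \<in> K" using z by (simp add: K_def)
        from k(2)[OF this] z Vk show False by simp
      qed
    qed (use Vk in simp)
  qed
qed

text \<open>Let \<open>l\<close> be the infimum of \<open>V\<close> over the reachable set. If \<open>l > 0\<close>, reachable points \<open>Y n\<close> with values
  tending to \<open>l\<close> accumulate at some \<open>p \<noteq> 0\<close> by compactness, and one descent step of size \<open>d\<close> from a point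
  close to \<open>p\<close> goes below \<open>l\<close>.\<close>
lemma reach_sublevel:
  assumes "a > 0"
  obtains y \<tau> where "steers f g {z. V z \<le> 2 * V q} q y \<tau>" "V y \<le> a"
proof -
  define C where "C = {z. V z \<le> 2 * V q}"
  define R where "R = {y. V y \<le> V q \<and> (\<exists>\<tau>. steers f g C q y \<tau>)}"
  have qR: "q \<in> R"
    using steers_refl[of q C f g] V_nonneg[of q] by (auto simp: R_def C_def)
  have "\<exists>y\<in>R. V y \<le> a"
  proof (rule ccontr)
    assume "\<not> (\<exists>y\<in>R. V y \<le> a)"
    then have above: "V y > a" if "y \<in> R" for y using that by force
    define l where "l = Inf (V ` R)"
    have bdd: "bdd_below (V ` R)" using V_nonneg by (intro bdd_belowI[of _ 0]) auto
    have l_le: "l \<le> V y" if "y \<in> R" for y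
      unfolding l_def using bdd that by (intro cInf_lower) auto
    have l_pos: "l > 0"
    proof -
      have "a \<le> l" unfolding l_def using qR above by (intro cInf_greatest) (auto intro: less_imp_le)
      then show ?thesis using assms by simp
    qed
    have "\<exists>y\<in>R. V y < l + 1 / real (Suc n)" for n
      using cInf_lessD[of "V ` R" "l + 1 / real (Suc n)"] qR unfolding l_def by auto
    then obtain Y where Y: "\<And>n. Y n \<in> R" "\<And>n. V (Y n) < l + 1 / real (Suc n)" by metis
    have "\<forall>n. Y n \<in> {z. V z \<le> V q}" using Y(1) by (simp add: R_def)
    then obtain p r where p: "strict_mono r" "(Y \<circ> r) \<longlonglongrightarrow> p"
      using sublevel_compact[of "V q"] unfolding compact_def by blast
    have "isCont V p" using V_cont by (simp add: continuous_on_eq_continuous_at)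
    then have "(\<lambda>n. V ((Y \<circ> r) n)) \<longlonglongrightarrow> V p" using p(2) by (rule isCont_tendsto_compose)
    then have "l \<le> V p"
      by (rule LIMSEQ_le_const) (use l_le Y(1) in auto)
    then have "p \<noteq> 0" using l_pos V0 by auto
    from descent[OF this] obtain \<rho> d where \<rho>: "\<rho> > 0" "d > 0"
      "\<And>q. q \<in> ball p \<rho> \<Longrightarrow> \<exists>y \<tau>. steers f g {z. V z \<le> 2 * V q} q y \<tau> \<and> V y \<le> V q - d"
      by blast
    have "eventually (\<lambda>n. (Y \<circ> r) n \<in> ball p \<rho>) sequentially"
      using p(2) \<rho>(1) by (auto simp: tendsto_iff dist_commute)
    moreover have "eventually (\<lambda>n. 1 / real (Suc n) < d) sequentially"
      using order_tendstoD(2)[OF LIMSEQ_Suc[OF lim_1_over_n[where 'a=real]] \<rho>(2)] by simp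
    ultimately obtain n where n: "(Y \<circ> r) n \<in> ball p \<rho>" "1 / real (Suc n) < d"
      by (metis (mono_tags, lifting) eventually_conj eventually_sequentially order_refl)
    define y where "y = Y (r n)"
    have yR: "y \<in> R" using Y(1) by (simp add: y_def)
    have "1 / real (Suc (r n)) \<le> 1 / real (Suc n)"
      using seq_suble[OF p(1), of n] by (intro divide_left_mono) auto
    then have Vy: "V y < l + d" using Y(2)[of "r n"] n(2) by (simp add: y_def)
    obtain z \<tau> where z: "steers f g {w. V w \<le> 2 * V y} y z \<tau>" "V z \<le> V y - d"
      using \<rho>(3)[of y] n(1) by (auto simp: y_def)
    obtain \<sigma> where \<sigma>: "steers f g C q y \<sigma>" using yR by (auto simp: R_def)
    have "{w. V w \<le> 2 * V y} \<subseteq> C" using yR by (auto simp: R_def C_def)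
    with steers_trans[OF \<sigma> steers_mono[OF z(1)]] have "steers f g C q z (\<sigma> + \<tau>)" by blast
    then have "z \<in> R" using z(2) \<rho>(2) yR by (auto simp: R_def)
    from l_le[OF this] z(2) Vy show False by simp
  qed
  then show thesis using that by (auto simp: R_def C_def)
qed

text \<open>The origin is an equilibrium of the uncontrolled system, and solutions double their distance to it at
  most over a time step of length \<open>\<tau>0\<close>; finitely many such steps cover any given duration.\<close>
lemma hold_near_zero:
  assumes "b > 0" "\<Theta> \<ge> 0"
  obtains a where "a > 0" "\<And>q. V q \<le> a \<Longrightarrow> \<exists>y. steers f g {z. V z \<le> b} q y \<Theta>"
proof -
  obtain \<tau>0 M Y where \<tau>0: "\<tau>0 > 0"
    and Y0: "\<And>\<tau> q. Y \<tau> q 0 = q"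
    and dY: "\<And>\<tau> q s. 0 < \<tau> \<Longrightarrow> \<tau> \<le> \<tau>0 \<Longrightarrow> q \<in> cball 0 (1/2) \<Longrightarrow> s \<in> {0..1} \<Longrightarrow>
       (Y \<tau> q has_vector_derivative \<tau> *\<^sub>R (f (Y \<tau> q s) + (0::real) *\<^sub>R g (Y \<tau> q s))) (at s within {0..1})"
    and "\<And>\<tau> q s. 0 < \<tau> \<Longrightarrow> \<tau> \<le> \<tau>0 \<Longrightarrow> q \<in> cball 0 (1/2) \<Longrightarrow> s \<in> {0..1} \<Longrightarrow> Y \<tau> q s \<in> cball 0 1"
    and "\<And>\<tau> q s. 0 < \<tau> \<Longrightarrow> \<tau> \<le> \<tau>0 \<Longrightarrow> s \<in> {0..1} \<Longrightarrow> norm (Y \<tau> q s - q) \<le> \<tau> * M"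
    and YL: "\<And>\<tau> q q' s. 0 < \<tau> \<Longrightarrow> \<tau> \<le> \<tau>0 \<Longrightarrow> s \<in> {0..1} \<Longrightarrow> norm (Y \<tau> q s - Y \<tau> q' s) \<le> 2 * norm (q - q')"
    and Yfix: "\<And>\<tau> s. 0 < \<tau> \<Longrightarrow> \<tau> \<le> \<tau>0 \<Longrightarrow> s \<in> {0..1} \<Longrightarrow> Y \<tau> 0 s = 0"
  proof (rule local_flow[OF smooth_f smooth_g continuous_on_const[of "{0..1}" 0], of 0], goal_cases)
    case prems: (1 \<tau>0 M Y)
    have fix0: "Y \<tau> 0 s = 0" if "0 < \<tau>" "\<tau> \<le> \<tau>0" "s \<in> {0..1}" for \<tau> s
      using prems(8)[of \<tau> 0 s] that f0 by simp
    show ?case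
      by (rule that[of \<tau>0 Y M]) (rule prems fix0; assumption)+
  qed
  have step: "\<exists>a>0. \<forall>q. V q \<le> a \<longrightarrow> (\<exists>y. steers f g {z. V z \<le> c} q y \<tau>0)" if c: "c > 0" for c
  proof -
    obtain \<delta> where \<delta>: "\<delta> > 0" "\<And>z. norm z \<le> \<delta> \<Longrightarrow> V z \<le> c" using small_norm_small_V[OF c] by blast
    obtain a where a: "a > 0" "\<And>z. V z \<le> a \<Longrightarrow> norm z < min (1/2) (\<delta> / 2)"
      using small_V_small_norm[of "min (1/2) (\<delta> / 2)"] \<delta>(1) by auto
    have "steers f g {z. V z \<le> c} q (Y \<tau>0 q 1) \<tau>0" if q: "V q \<le> a" for q
    proof -
      have nq: "norm q < 1/2" "norm q < \<delta> / 2" using a(2)[OF q] by auto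
      have "norm (Y \<tau>0 q s) \<le> 2 * norm q" if s: "s \<in> {0..1}" for s
      proof -
        have "Y \<tau>0 0 s = 0" by (rule Yfix) (use \<tau>0 s f0 in auto)
        then show ?thesis using YL[OF \<tau>0 order_refl s, of q 0] by simp
      qed
      then have "Y \<tau>0 q ` {0..1} \<subseteq> {z. V z \<le> c}"
        using nq \<delta>(2) by fastforce
      moreover have "q \<in> cball 0 (1/2)" using nq by simp
      ultimately have "steers f g {z. V z \<le> c} (Y \<tau>0 q 0) (Y \<tau>0 q 1) \<tau>0"
        by (intro steers_rescaled[OF \<tau>0 continuous_on_const[of _ 0]] dY[OF \<tau>0 order_refl])
      then show ?thesis by (simp add: Y0)
    qed
    then show ?thesis using a(1) by blast
  qed
  have chain: "\<exists>a>0. \<forall>q. V q \<le> a \<longrightarrow> (\<exists>y. steers f g {z. V z \<le> b} q y (real N * \<tau>0))" for N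
  proof (induction N)
    case 0
    then show ?case using assms(1) steers_refl[of _ "{z. V z \<le> b}" f g] by auto
  next
    case (Suc N)
    then obtain a where a: "a > 0" "\<And>q. V q \<le> a \<Longrightarrow> \<exists>y. steers f g {z. V z \<le> b} q y (real N * \<tau>0)"
      by blast
    obtain a' where a': "a' > 0" "\<And>q. V q \<le> a' \<Longrightarrow> \<exists>y. steers f g {z. V z \<le> min a b} q y \<tau>0"
      using step[of "min a b"] a(1) assms(1) by auto
    have "\<exists>y. steers f g {z. V z \<le> b} q y (real (Suc N) * \<tau>0)" if q: "V q \<le> a'" for q
    proof -
      obtain y where y: "steers f g {z. V z \<le> min a b} q y \<tau>0" using a'(2)[OF q] by blast
      have "V y \<le> a" using steers_start_end[OF y] by auto
      then obtain z where z: "steers f g {z. V z \<le> b} y z (real N * \<tau>0)" using a(2) by blast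
      have "steers f g {z. V z \<le> b} q y \<tau>0" by (rule steers_mono[OF y]) auto
      from steers_trans[OF this z] show ?thesis by (auto simp: algebra_simps)
    qed
    then show ?case using a'(1) by blast
  qed
  obtain N where N: "\<Theta> < real N * \<tau>0" using ex_less_of_nat_mult[OF \<tau>0] by blast
  obtain a where a: "a > 0" "\<And>q. V q \<le> a \<Longrightarrow> \<exists>y. steers f g {z. V z \<le> b} q y (real N * \<tau>0)"
    using chain by blast
  show thesis
  proof (rule that[OF a(1)])
    fix q assume "V q \<le> a"
    then obtain y where "steers f g {z. V z \<le> b} q y (real N * \<tau>0)" using a(2) by blast
    then show "\<exists>y. steers f g {z. V z \<le> b} q y \<Theta>"
      using steers_truncate assms(2) less_imp_le[OF N] by blast
  qed
qed

text \<open>Repeated descent alone might exhaust only a bounded amount of time. Going down until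
  the uncontrolled system stays within the sublevel set for the whole duration avoids this.\<close>
lemma stay_in_sublevel:
  assumes "b > 0" "V q \<le> b / 2" "\<Theta> \<ge> 0"
  obtains y where "steers f g {z. V z \<le> b} q y \<Theta>"
proof -
  obtain a where a: "a > 0" "\<And>q. V q \<le> a \<Longrightarrow> \<exists>y. steers f g {z. V z \<le> b} q y \<Theta>"
    using hold_near_zero[OF assms(1,3)] by blast
  obtain y \<tau> where y: "steers f g {z. V z \<le> 2 * V q} q y \<tau>" "V y \<le> a"
    using reach_sublevel[OF a(1)] by blast
  have y': "steers f g {z. V z \<le> b} q y \<tau>"
    by (rule steers_mono[OF y(1)]) (use assms(2) in auto)
  obtain w where "steers f g {z. V z \<le> b} y w \<Theta>" using a(2)[OF y(2)] by blast
  from steers_trans[OF y' this] have "steers f g {z. V z \<le> b} q w (\<tau> + \<Theta>)" .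
  moreover have "\<tau> \<ge> 0" using y(1) by (simp add: steers_def)
  ultimately show thesis using steers_truncate[of f g _ q w "\<tau> + \<Theta>" \<Theta>] assms(3) that by auto
qed

lemma descend_and_wait:
  assumes "e > 0" "e \<le> b" "V q \<le> b / 2"
  obtains \<Theta>0 where "\<And>\<Theta>. \<Theta> \<ge> \<Theta>0 \<Longrightarrow> \<exists>y. steers f g {z. V z \<le> b} q y \<Theta> \<and> V y \<le> e"
proof -
  obtain y \<tau> where y: "steers f g {z. V z \<le> 2 * V q} q y \<tau>" "V y \<le> e / 2"
    using reach_sublevel[of "e / 2"] assms(1) by (metis half_gt_zero)
  have y': "steers f g {z. V z \<le> b} q y \<tau>"
    by (rule steers_mono[OF y(1)]) (use assms(3) in auto)
  show thesis
  proof (rule that[of \<tau>])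
    fix \<Theta> assume "\<Theta> \<ge> \<tau>"
    then obtain w where w: "steers f g {z. V z \<le> e} y w (\<Theta> - \<tau>)"
      using stay_in_sublevel[OF assms(1) y(2), of "\<Theta> - \<tau>"] by auto
    have "steers f g {z. V z \<le> b} y w (\<Theta> - \<tau>)"
      by (rule steers_mono[OF w]) (use assms(2) in auto)
    from steers_trans[OF y' this] have "steers f g {z. V z \<le> b} q w \<Theta>" by simp
    moreover have "V w \<le> e" using steers_start_end[OF w] by simp
    ultimately show "\<exists>y. steers f g {z. V z \<le> b} q y \<Theta> \<and> V y \<le> e" by blast
  qed
qed

end

section \<open>Uniqueness of Caratheodory solutions\<close>

text \<open>\<open>W(t) exp(-L (t - a))\<close> is nonincreasing for \<open>W\<close> the primitive of \<open>w\<close> that vanishes at \<open>a\<close>.\<close>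
lemma gronwall_zero:
  fixes w :: "real \<Rightarrow> real"
  assumes w: "continuous_on {a..b} w" and L: "L \<ge> 0"
    and ineq: "\<And>t. t \<in> {a..b} \<Longrightarrow> w t \<le> L * integral {a..t} w"
    and t: "t \<in> {a..b}"
  shows "w t \<le> 0"
proof -
  define W where "W t = integral {a..t} w" for t
  define z where "z t = W t * exp (- L * (t - a))" for t
  have dW: "(W has_real_derivative w s) (at s within {a..b})" if "s \<in> {a..b}" for s
    unfolding W_def[abs_def] has_real_derivative_iff_has_vector_derivative
    by (rule integral_has_vector_derivative[OF w that])
  have W_cont: "continuous_on {a..b} W"
    unfolding continuous_on_eq_continuous_within using dW DERIV_continuous by blast
  have "z t \<le> z a"
  proof (rule DERIV_nonpos_imp_decreasing_open[of a t z])
    show "a \<le> t" using t by simp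
    show "continuous_on {a..t} z"
      unfolding z_def[abs_def] using t by (intro continuous_intros continuous_on_subset[OF W_cont]) auto
    fix s assume s: "a < s" "s < t"
    have "(W has_real_derivative w s) (at s)"
      using dW[of s] s t at_within_interior[of s "{a..b}"] by (simp add: interior_atLeastAtMost_real)
    then have "(z has_real_derivative w s * exp (- L * (s - a)) + W s * (exp (- L * (s - a)) * (- L))) (at s)"
      unfolding z_def[abs_def] by (auto intro!: derivative_eq_intros)
    moreover have "w s * exp (- L * (s - a)) + W s * (exp (- L * (s - a)) * (- L))
        = (w s - L * W s) * exp (- L * (s - a))"
      by (simp add: algebra_simps)
    moreover have "(w s - L * W s) * exp (- L * (s - a)) \<le> 0"
      using ineq[of s] s t by (intro mult_nonpos_nonneg) (auto simp: W_def)
    ultimately show "\<exists>y. (z has_real_derivative y) (at s) \<and> y \<le> 0" by metis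
  qed
  then have "W t \<le> 0"
    by (simp add: z_def W_def mult_le_0_iff)
  then have "L * W t \<le> 0" using L by (simp add: mult_nonneg_nonpos)
  then show ?thesis using ineq[OF t] by (simp add: W_def)
qed

lemma integral_equation_unique:
  fixes f g :: "'a::euclidean_space \<Rightarrow> 'a" and v :: "real \<Rightarrow> real"
  assumes smooth: "smooth f" "smooth g"
    and v: "\<And>s. s \<in> {a..b} \<Longrightarrow> \<bar>v s\<bar> \<le> C"
    and x: "\<And>t. t \<in> {a..b} \<Longrightarrow> (\<lambda>s. f (x s) + v s *\<^sub>R g (x s)) integrable_on {a..t}"
      "\<And>t. t \<in> {a..b} \<Longrightarrow> x t = q + integral {a..t} (\<lambda>s. f (x s) + v s *\<^sub>R g (x s))"
    and y: "\<And>t. t \<in> {a..b} \<Longrightarrow> (\<lambda>s. f (y s) + v s *\<^sub>R g (y s)) integrable_on {a..t}"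
      "\<And>t. t \<in> {a..b} \<Longrightarrow> y t = q + integral {a..t} (\<lambda>s. f (y s) + v s *\<^sub>R g (y s))"
    and t: "t \<in> {a..b}"
  shows "x t = y t"
proof -
  have ab: "b \<in> {a..b}" using t by auto
  have C: "C \<ge> 0" using v[OF t] by linarith
  have x_cont: "continuous_on {a..b} x"
  proof (rule continuous_on_eq)
    show "continuous_on {a..b} (\<lambda>t. q + integral {a..t} (\<lambda>s. f (x s) + v s *\<^sub>R g (x s)))"
      by (intro continuous_on_add continuous_on_const indefinite_integral_continuous_1 x(1) ab)
  qed (use x(2) in auto)
  have y_cont: "continuous_on {a..b} y"
  proof (rule continuous_on_eq)
    show "continuous_on {a..b} (\<lambda>t. q + integral {a..t} (\<lambda>s. f (y s) + v s *\<^sub>R g (y s)))"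
      by (intro continuous_on_add continuous_on_const indefinite_integral_continuous_1 y(1) ab)
  qed (use y(2) in auto)
  have "bounded (x ` {a..b} \<union> y ` {a..b})"
    by (intro bounded_Un[THEN iffD2] conjI compact_imp_bounded compact_continuous_image x_cont y_cont) auto
  then obtain r where r: "\<forall>z\<in>x ` {a..b} \<union> y ` {a..b}. norm z \<le> r"
    unfolding bounded_iff by blast
  then have xr: "x s \<in> cball 0 r" and yr: "y s \<in> cball 0 r" if "s \<in> {a..b}" for s
    using that by auto
  obtain Lf where Lf: "Lf > 0" "\<And>x y. x \<in> cball 0 r \<Longrightarrow> y \<in> cball 0 r \<Longrightarrow> norm (f x - f y) \<le> Lf * norm (x - y)"
    using smooth_lipschitz_on_cball[OF smooth(1)] by metis
  obtain Lg where Lg: "Lg > 0" "\<And>x y. x \<in> cball 0 r \<Longrightarrow> y \<in> cball 0 r \<Longrightarrow> norm (g x - g y) \<le> Lg * norm (x - y)"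
    using smooth_lipschitz_on_cball[OF smooth(2)] by metis
  define L where "L = Lf + C * Lg"
  have L: "L \<ge> 0" using Lf(1) Lg(1) C by (simp add: L_def)
  define w where "w s = norm (x s - y s)" for s
  have w_cont: "continuous_on {a..b} w"
    unfolding w_def by (intro continuous_intros x_cont y_cont)
  have "w t \<le> 0"
  proof (rule gronwall_zero[OF w_cont L _ t])
    fix t assume t: "t \<in> {a..b}"
    have w_int: "w integrable_on {a..t}"
      using t by (intro integrable_continuous_real continuous_on_subset[OF w_cont]) auto
    have "x t - y t = integral {a..t} (\<lambda>s. (f (x s) + v s *\<^sub>R g (x s)) - (f (y s) + v s *\<^sub>R g (y s)))"
      using x(2)[OF t] y(2)[OF t] integral_diff[OF x(1)[OF t] y(1)[OF t]] by simp
    also have "norm \<dots> \<le> integral {a..t} (\<lambda>s. L * w s)"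
    proof (rule integral_norm_bound_integral)
      show "(\<lambda>s. (f (x s) + v s *\<^sub>R g (x s)) - (f (y s) + v s *\<^sub>R g (y s))) integrable_on {a..t}"
        by (rule integrable_diff[OF x(1)[OF t] y(1)[OF t]])
      show "(\<lambda>s. L * w s) integrable_on {a..t}" by (rule integrable_on_mult_right[OF w_int])
      fix s assume "s \<in> {a..t}"
      then have s: "s \<in> {a..b}" using t by auto
      have "(f (x s) + v s *\<^sub>R g (x s)) - (f (y s) + v s *\<^sub>R g (y s))
          = (f (x s) - f (y s)) + v s *\<^sub>R (g (x s) - g (y s))"
        by (simp add: algebra_simps)
      also have "norm \<dots> \<le> Lf * w s + C * (Lg * w s)"
        using Lf(2)[OF xr[OF s] yr[OF s]] Lg(2)[OF xr[OF s] yr[OF s]] v[OF s] C unfolding w_def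
        by (intro order_trans[OF norm_triangle_ineq] add_mono) (auto intro!: mult_mono)
      finally show "norm ((f (x s) + v s *\<^sub>R g (x s)) - (f (y s) + v s *\<^sub>R g (y s))) \<le> L * w s"
        by (simp add: L_def algebra_simps)
    qed
    also have "\<dots> = L * integral {a..t} w" by simp
    finally show "w t \<le> L * integral {a..t} w" by (simp add: w_def)
  qed
  then show ?thesis by (simp add: w_def)
qed

text \<open>The input \<open>v\<close> need agree with the shifted control only inside the interval: at its right end a
  sampled-data feedback already switches to the next piece.\<close>
lemma controlled_motion_integral_equation:
  fixes f g :: "'a::euclidean_space \<Rightarrow> 'a" and v :: "real \<Rightarrow> real"
  assumes smooth: "smooth f" "smooth g"
    and z: "controlled_motion f g u z h"
    and v: "\<And>s. s \<in> {a<..<a + h} \<Longrightarrow> v s = u (s - a)"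
    and vC: "\<And>s. s \<in> {a..a + h} \<Longrightarrow> \<bar>v s\<bar> \<le> C"
    and t: "t \<in> {a..a + h}"
  shows "(\<lambda>s. f (z (s - a)) + v s *\<^sub>R g (z (s - a))) absolutely_integrable_on {a..t}"
    and "z (t - a) = z 0 + integral {a..t} (\<lambda>s. f (z (s - a)) + v s *\<^sub>R g (z (s - a)))"
proof -
  obtain S where S: "finite S" "\<And>t. t \<in> {0<..<h} - S \<Longrightarrow> (z has_vector_derivative f (z t) + u t *\<^sub>R g (z t)) (at t)"
    using z unfolding controlled_motion_def by blast
  have "continuous_on {0..h} z" using z by (simp add: controlled_motion_def)
  then have "continuous_on {a..a + h} (\<lambda>s. z (s - a))"
    by (rule continuous_on_compose2) (auto intro!: continuous_intros)
  then have cont: "continuous_on {a..t} (\<lambda>s. z (s - a))"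
    by (rule continuous_on_subset) (use t in auto)
  let ?F = "\<lambda>s. f (z (s - a)) + v s *\<^sub>R g (z (s - a))"
  have int: "(?F has_integral (z (t - a) - z (a - a))) {a..t}"
  proof (rule fundamental_theorem_of_calculus_interior_strong[of "(\<lambda>s. s + a) ` S"])
    show "continuous_on {a..t} (\<lambda>s. z (s - a))" by (rule cont)
    fix s assume s: "s \<in> {a<..<t} - (\<lambda>s. s + a) ` S"
    have "s - a \<notin> S"
    proof
      assume "s - a \<in> S"
      then have "(s - a) + a \<in> (\<lambda>s. s + a) ` S" by (rule imageI)
      then show False using s by simp
    qed
    then have "(z has_vector_derivative f (z (s - a)) + u (s - a) *\<^sub>R g (z (s - a))) (at (s + - a))"
      using S(2)[of "s - a"] s t by auto
    from has_vector_derivative_shift[OF this]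
    show "((\<lambda>s. z (s - a)) has_vector_derivative ?F s) (at s)"
      using v[of s] s t by auto
  qed (use S(1) t in auto)
  then show "z (t - a) = z 0 + integral {a..t} ?F" by (simp add: integral_unique)
  have fz: "bounded ((\<lambda>s. f (z (s - a))) ` {a..t})" and gz: "bounded ((\<lambda>s. g (z (s - a))) ` {a..t})"
    by (intro compact_imp_bounded compact_continuous_image
        continuous_on_compose2[OF smooth_continuous_on[OF smooth(1), of UNIV] cont]
        continuous_on_compose2[OF smooth_continuous_on[OF smooth(2), of UNIV] cont]; simp)+
  obtain Bf where Bf: "\<And>s. s \<in> {a..t} \<Longrightarrow> norm (f (z (s - a))) \<le> Bf"
    using fz unfolding bounded_iff by fastforce
  obtain Bg where Bg: "\<And>s. s \<in> {a..t} \<Longrightarrow> norm (g (z (s - a))) \<le> Bg"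
    using gz unfolding bounded_iff by fastforce
  have "norm (?F s) \<le> Bf + C * Bg" if s: "s \<in> {a..t}" for s
  proof -
    have "\<bar>v s\<bar> \<le> C" using vC[of s] s t by auto
    then have "norm (v s *\<^sub>R g (z (s - a))) \<le> C * Bg"
      unfolding norm_scaleR using Bg[OF s] by (intro mult_mono) auto
    then show ?thesis using Bf[OF s] by (intro order_trans[OF norm_triangle_ineq] add_mono)
  qed
  then show "?F absolutely_integrable_on {a..t}"
    using int by (intro absolutely_integrable_integrable_bound[of _ ?F "\<lambda>s. Bf + C * Bg"]) auto
qed

section \<open>Dynamic programming along the partition\<close>

text \<open>Negative indices are admitted so that every state lies below some level.\<close>
definition level :: "int \<Rightarrow> real" where
  "level j = 4 powi (- j)"

lemma level_pos: "level j > 0"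
  by (simp add: level_def)

lemma level_Suc: "level j = 4 * level (j + 1)"
proof -
  have "(4::real) powi (- j) = 4 powi (1 + (- (j + 1)))" by simp
  also have "\<dots> = 4 powi 1 * 4 powi (- (j + 1))" by (rule power_int_add) simp
  finally show ?thesis by (simp add: level_def)
qed

lemma level_antimono: "i \<le> j \<Longrightarrow> level j \<le> level i"
  unfolding level_def by (intro power_int_increasing) auto

lemma level_arbitrarily_small:
  assumes "b > 0"
  obtains j where "j \<ge> j0" "level j < b"
proof -
  obtain n where n: "(1/4::real) ^ n < b"
    using real_arch_pow_inv[OF assms, of "1/4"] by auto
  have "level (int n) = (1/4) ^ n"
    by (simp add: level_def power_int_minus power_int_of_nat power_one_over inverse_eq_divide)
  then have "level (max j0 (int n)) < b"
    using level_antimono[of "int n" "max j0 (int n)"] n by simp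
  then show thesis by (intro that[of "max j0 (int n)"]) auto
qed

lemma level_arbitrarily_large: obtains j where "b \<le> level j"
proof -
  obtain n where n: "b < 4 ^ n"
    using real_arch_pow[of 4 b] by auto
  have "level (- int n) = 4 ^ n" by (simp add: level_def power_int_of_nat)
  then show thesis using n by (intro that[of "- int n"]) simp
qed

locale sampled_lyapunov = steerable_lyapunov +
  fixes T :: "nat \<Rightarrow> real"
  assumes partition: "time_partition T"
begin

lemma T0: "T 0 = 0" and T_less: "i < j \<Longrightarrow> T i < T j" and T_mono: "i \<le> j \<Longrightarrow> T i \<le> T j"
  using partition by (auto simp: time_partition_def strict_mono_def strict_mono_less_eq)

lemma T_exceeds: obtains n where "n \<ge> i" "c \<le> T n"
proof -
  have "eventually (\<lambda>n. c \<le> T n) sequentially"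
    using partition by (auto simp: time_partition_def filterlim_at_top)
  then obtain N where "\<And>n. n \<ge> N \<Longrightarrow> c \<le> T n" by (auto simp: eventually_sequentially)
  then show thesis by (intro that[of "max i N"]) auto
qed

definition plan :: "int \<Rightarrow> nat \<Rightarrow> nat \<Rightarrow> 'a \<Rightarrow> bool" where
  "plan j i m q \<longleftrightarrow> (\<exists>y. steers f g {z. V z \<le> 2 * level j} q y (T (i + m) - T i) \<and> V y \<le> level (j + 1))"

definition attainable :: "int \<Rightarrow> nat \<Rightarrow> 'a \<Rightarrow> bool" where
  "attainable j i q \<longleftrightarrow> (\<exists>m. plan j i m q)"

text \<open>The plan must end exactly at a sampling time, so the state waits below \<open>level (j + 1)\<close> for the next
  one.\<close>
lemma attainable_if_below:
  assumes "V q \<le> level j"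
  shows "attainable j i q"
proof -
  obtain \<Theta>0 where \<Theta>0: "\<And>\<Theta>. \<Theta> \<ge> \<Theta>0 \<Longrightarrow> \<exists>y. steers f g {z. V z \<le> 2 * level j} q y \<Theta> \<and> V y \<le> level (j + 1)"
    using descend_and_wait[of "level (j + 1)" "2 * level j" q] level_pos[of "j + 1"] level_Suc[of j] assms
    by auto
  obtain n where n: "n \<ge> i" "\<Theta>0 + T i \<le> T n" by (rule T_exceeds)
  then have "plan j i (n - i) q" unfolding plan_def using \<Theta>0[of "T n - T i"] by simp
  then show ?thesis unfolding attainable_def by blast
qed

lemma attainable_bound: "attainable j i q \<Longrightarrow> V q \<le> 2 * level j"
  unfolding attainable_def plan_def using steers_start_end by fastforce

lemma attainable_antimono:
  assumes "attainable j i q" "j' \<le> j"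
  shows "attainable j' i q"
proof -
  obtain m y where y: "steers f g {z. V z \<le> 2 * level j} q y (T (i + m) - T i)" "V y \<le> level (j + 1)"
    using assms(1) unfolding attainable_def plan_def by blast
  have "steers f g {z. V z \<le> 2 * level j'} q y (T (i + m) - T i)"
    by (rule steers_mono[OF y(1)]) (use level_antimono[OF assms(2)] in auto)
  moreover have "V y \<le> level (j' + 1)"
    using y(2) level_antimono[of "j' + 1" "j + 1"] assms(2) by simp
  ultimately show ?thesis unfolding attainable_def plan_def by blast
qed

text \<open>Attainable indices are bounded above because \<open>V q \<le> 2 * level j\<close>, and levels tend to 0.\<close>
lemma best_level:
  assumes "q \<noteq> 0"
  obtains J where "attainable J i q" "\<And>j. attainable j i q \<Longrightarrow> j \<le> J"
proof -
  have "V q / 2 > 0" using V_pos[OF assms] by simp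
  then obtain j0 where "level j0 < V q / 2" by (rule level_arbitrarily_small)
  then have below: "j < j0" if "attainable j i q" for j
    using attainable_bound[OF that] level_antimono[of j0 j] by force
  obtain j1 where j1: "V q \<le> level j1" by (rule level_arbitrarily_large)
  have ex: "attainable (j0 - int (nat (j0 - j1))) i q"
    using attainable_if_below[OF j1, of i] below[of j1] by simp
  define n where "n = (LEAST n. attainable (j0 - int n) i q)"
  have n: "attainable (j0 - int n) i q" unfolding n_def using ex by (rule LeastI)
  show thesis
  proof (rule that[OF n])
    fix j assume j: "attainable j i q"
    then have "attainable (j0 - int (nat (j0 - j))) i q" using below[OF j] by simp
    then have "n \<le> nat (j0 - j)" unfolding n_def by (rule Least_le)
    then show "j \<le> j0 - int n" using below[OF j] by simp
  qed
qed

text \<open>For \<open>q \<noteq> 0\<close> the control is the first piece of a plan with the greatest attainable index \<open>J\<close> and the least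
  number \<open>M\<close> of intervals; what remains of the plan attains \<open>J\<close> from the next sampling time in
  \<open>M - 1\<close> intervals. The properties are stated for all \<open>j\<close>, not just for \<open>J\<close>, so that they can be
  iterated along a trajectory without tracking \<open>J\<close>.\<close>
lemma feedback_exists:
  "\<exists>u x. controlled_motion f g u x (T (Suc i) - T i) \<and> x 0 = q \<and>
     (\<forall>j. attainable j i q \<longrightarrow> (\<forall>t\<in>{0..T (Suc i) - T i}. V (x t) \<le> 2 * level j) \<and>
        attainable j (Suc i) (x (T (Suc i) - T i))) \<and>
     (\<forall>j m. plan j i m q \<longrightarrow> attainable (j + 1) i q \<or> (\<exists>m'<m. plan j (Suc i) m' (x (T (Suc i) - T i))))"
proof (cases "q = 0")
  case True
  have g0: "attainable j i 0" for j i
    using attainable_if_below[of 0 j i] V0 level_pos[of j] by simp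
  show ?thesis
    by (rule exI[of _ "\<lambda>t. 0"], rule exI[of _ "\<lambda>t. 0"])
       (use True g0 f0 V0 level_pos in \<open>simp add: controlled_motion_const less_imp_le\<close>)
next
  case False
  obtain J where J: "attainable J i q" "\<And>j. attainable j i q \<Longrightarrow> j \<le> J" using best_level[OF False] by blast
  define M where "M = (LEAST m. plan J i m q)"
  have M: "plan J i M q" unfolding M_def using J(1) unfolding attainable_def by (metis LeastI)
  have M_le: "M \<le> m" if "plan J i m q" for m unfolding M_def using that by (rule Least_le)
  obtain y where y: "steers f g {z. V z \<le> 2 * level J} q y (T (i + M) - T i)" "V y \<le> level (J + 1)"
    using M unfolding plan_def by blast
  have "M \<noteq> 0"
  proof
    assume "M = 0"
    then have "y = q" using y(1) by (auto simp: steers_def)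
    then have "attainable (J + 1) i q" using y(2) by (intro attainable_if_below) simp
    then show False using J(2) by fastforce
  qed
  then obtain m' where m': "M = Suc m'" using not0_implies_Suc by blast
  let ?h = "T (Suc i) - T i"
  have h: "0 \<le> ?h" "?h \<le> T (i + M) - T i" using T_mono[of i "Suc i"] T_mono[of "Suc i" "i + M"] m' by auto
  obtain u x where x: "controlled_motion f g u x ?h" "x 0 = q" "x ` {0..?h} \<subseteq> {z. V z \<le> 2 * level J}"
    "steers f g {z. V z \<le> 2 * level J} (x ?h) y (T (i + M) - T i - ?h)"
    using steers_split[OF y(1) h] by blast
  have next_plan: "plan J (Suc i) m' (x ?h)"
    unfolding plan_def using x(4) y(2) m' by (intro exI[of _ y]) simp
  then have next_good: "attainable J (Suc i) (x ?h)" unfolding attainable_def by blast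
  show ?thesis
  proof (intro exI[of _ u] exI[of _ x] conjI allI impI ballI)
    show "controlled_motion f g u x ?h" "x 0 = q" by fact+
    fix j
    show "V (x t) \<le> 2 * level j" if "attainable j i q" "t \<in> {0..?h}" for t
      using x(3) that(2) level_antimono[OF J(2)[OF that(1)]] by force
    show "attainable j (Suc i) (x ?h)" if "attainable j i q"
      by (rule attainable_antimono[OF next_good J(2)[OF that]])
    show "attainable (j + 1) i q \<or> (\<exists>m'<m. plan j (Suc i) m' (x ?h))" if p: "plan j i m q" for m
    proof (cases "j = J")
      case True
      then have "m' < m" using M_le[of m] p m' by simp
      then show ?thesis using next_plan True by blast
    next
      case False
      have "j \<le> J" using p J(2) unfolding attainable_def by blast
      then have "attainable (j + 1) i q" using False by (intro attainable_antimono[OF J(1)]) simp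
      then show ?thesis by blast
    qed
  qed
qed

end

section \<open>Sampled-data feedback\<close>

context sampled_lyapunov
begin

text \<open>A choice, for each sampling index and state, of an open-loop control \<open>U\<close> and of the motion \<open>X\<close> that
  it produces, as provided by \<open>feedback_exists\<close>; both in the time elapsed since the sampling.\<close>
definition feedback_law :: "(nat \<Rightarrow> 'a \<Rightarrow> real \<Rightarrow> real) \<Rightarrow> (nat \<Rightarrow> 'a \<Rightarrow> real \<Rightarrow> 'a) \<Rightarrow> bool" where
  "feedback_law U X \<longleftrightarrow> (\<forall>i q. controlled_motion f g (U i q) (X i q) (T (Suc i) - T i) \<and> X i q 0 = q \<and>
     (\<forall>j. attainable j i q \<longrightarrow> (\<forall>t\<in>{0..T (Suc i) - T i}. V (X i q t) \<le> 2 * level j) \<and>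
        attainable j (Suc i) (X i q (T (Suc i) - T i))) \<and>
     (\<forall>j m. plan j i m q \<longrightarrow> attainable (j + 1) i q \<or> (\<exists>m'<m. plan j (Suc i) m' (X i q (T (Suc i) - T i)))))"

lemma feedback_law_exists: "\<exists>U X. feedback_law U X"
proof -
  have "\<exists>U. \<forall>i q. \<exists>x. controlled_motion f g (U i q) x (T (Suc i) - T i) \<and> x 0 = q \<and>
     (\<forall>j. attainable j i q \<longrightarrow> (\<forall>t\<in>{0..T (Suc i) - T i}. V (x t) \<le> 2 * level j) \<and>
        attainable j (Suc i) (x (T (Suc i) - T i))) \<and>
     (\<forall>j m. plan j i m q \<longrightarrow> attainable (j + 1) i q \<or> (\<exists>m'<m. plan j (Suc i) m' (x (T (Suc i) - T i))))"
    by (intro choice allI feedback_exists)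
  then obtain U where U: "\<And>i q. \<exists>x. controlled_motion f g (U i q) x (T (Suc i) - T i) \<and> x 0 = q \<and>
     (\<forall>j. attainable j i q \<longrightarrow> (\<forall>t\<in>{0..T (Suc i) - T i}. V (x t) \<le> 2 * level j) \<and>
        attainable j (Suc i) (x (T (Suc i) - T i))) \<and>
     (\<forall>j m. plan j i m q \<longrightarrow> attainable (j + 1) i q \<or> (\<exists>m'<m. plan j (Suc i) m' (x (T (Suc i) - T i))))"
    by blast
  have "\<exists>X. \<forall>i q. controlled_motion f g (U i q) (X i q) (T (Suc i) - T i) \<and> X i q 0 = q \<and>
     (\<forall>j. attainable j i q \<longrightarrow> (\<forall>t\<in>{0..T (Suc i) - T i}. V (X i q t) \<le> 2 * level j) \<and>
        attainable j (Suc i) (X i q (T (Suc i) - T i))) \<and>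
     (\<forall>j m. plan j i m q \<longrightarrow> attainable (j + 1) i q \<or> (\<exists>m'<m. plan j (Suc i) m' (X i q (T (Suc i) - T i))))"
    by (intro choice allI U)
  then show ?thesis unfolding feedback_law_def by blast
qed

definition sampling_index :: "real \<Rightarrow> nat" where
  "sampling_index t = (LEAST i. t < T (Suc i))"

lemma sampling_index_eq: "T i \<le> t \<Longrightarrow> t < T (Suc i) \<Longrightarrow> sampling_index t = i"
  unfolding sampling_index_def
proof (rule Least_equality)
  fix j assume "T i \<le> t" "t < T (Suc j)"
  then show "i \<le> j" using T_mono[of "Suc j" i] by (meson leD leI less_le_trans not_less_eq_eq)
qed

lemma sampling_index_bounds:
  assumes "t \<ge> 0"
  shows "T (sampling_index t) \<le> t" "t < T (Suc (sampling_index t))"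
proof -
  obtain n where "t + 1 \<le> T n" by (rule T_exceeds)
  then have "t < T (Suc n)" using T_less[of n "Suc n"] by simp
  then show "t < T (Suc (sampling_index t))" unfolding sampling_index_def by (rule LeastI)
  show "T (sampling_index t) \<le> t"
  proof (cases "sampling_index t")
    case 0
    then show ?thesis using T0 assms by simp
  next
    case (Suc i)
    then have "\<not> t < T (Suc i)"
      using not_less_Least[of i "\<lambda>i. t < T (Suc i)"] unfolding sampling_index_def by simp
    then show ?thesis using Suc by simp
  qed
qed

definition sampled_feedback :: "(nat \<Rightarrow> 'a \<Rightarrow> real \<Rightarrow> real) \<Rightarrow> real \<Rightarrow> 'a \<Rightarrow> real" where
  "sampled_feedback U t q = U (sampling_index t) q (t - T (sampling_index t))"

lemma sampled_feedback_admissible: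
  assumes "feedback_law U X"
  shows "admissible_input (\<lambda>t. sampled_feedback U t q)"
  unfolding admissible_input_def
proof (intro conjI allI impI)
  have U: "U i q \<in> borel_measurable borel" "bounded (range (U i q))" for i
    using assms by (auto simp: feedback_law_def controlled_motion_def)
  have idx: "sampling_index \<in> measurable borel (count_space UNIV)"
    unfolding sampling_index_def by measurable
  have "(\<lambda>t. U i q (t - T i)) \<in> borel_measurable borel" for i
    using U(1) by measurable
  then have "(\<lambda>t. sampled_feedback U t q) \<in> borel_measurable borel"
    unfolding sampled_feedback_def by (rule measurable_compose_countable[OF _ idx])
  then have "(\<lambda>t. sampled_feedback U t q) \<in> borel_measurable lebesgue"
    by (intro measurable_completion) simp
  then show "(\<lambda>t. sampled_feedback U t q) \<in> borel_measurable (lebesgue_on {0..})"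
    by (rule measurable_restrict_space1)
  fix K :: "real set" assume K: "compact K \<and> K \<subseteq> {0..}"
  have "\<exists>B. \<forall>s. \<bar>U i q s\<bar> \<le> B" for i
    using U(2)[of i] unfolding bounded_iff by auto
  then obtain B where B: "\<And>i s. \<bar>U i q s\<bar> \<le> B i" by metis
  have B0: "B i \<ge> 0" for i using B[of i 0] by linarith
  obtain b where b: "\<And>t. t \<in> K \<Longrightarrow> t \<le> b"
    using K compact_imp_bounded bounded_iff abs_le_D1 by (metis real_norm_def)
  obtain n where "b + 1 \<le> T n" by (rule T_exceeds)
  then have n: "b < T (Suc n)" using T_less[of n "Suc n"] by simp
  have "\<bar>sampled_feedback U t q\<bar> \<le> (\<Sum>i\<le>n. B i)" if "t \<in> K" for t
  proof -
    have "sampling_index t \<le> n"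
      unfolding sampling_index_def using b[OF that] n by (intro Least_le) simp
    then have "B (sampling_index t) \<le> (\<Sum>i\<le>n. B i)"
      using B0 by (intro member_le_sum) auto
    then show ?thesis unfolding sampled_feedback_def using B order_trans by blast
  qed
  then show "\<exists>C. AE t in lebesgue. t \<in> K \<longrightarrow> norm (sampled_feedback U t q) \<le> C"
    by (intro exI[of _ "\<Sum>i\<le>n. B i"] AE_I2) simp
qed

lemma piece_is_solution:
  assumes law: "feedback_law U X" and t: "t \<in> {T i..T (Suc i)}"
  shows "(\<lambda>s. f (X i q (s - T i)) + sampled_feedback U s q *\<^sub>R g (X i q (s - T i))) absolutely_integrable_on {T i..t}"
    and "X i q (t - T i) = q + integral {T i..t} (\<lambda>s. f (X i q (s - T i)) + sampled_feedback U s q *\<^sub>R g (X i q (s - T i)))"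
    and "\<exists>C. \<forall>s\<in>{T i..T (Suc i)}. \<bar>sampled_feedback U s q\<bar> \<le> C"
proof -
  have motion: "controlled_motion f g (U i q) (X i q) (T (Suc i) - T i)" and X0: "X i q 0 = q"
    using law by (auto simp: feedback_law_def)
  have Uq: "sampled_feedback U s q = U i q (s - T i)" if "T i \<le> s" "s < T (Suc i)" for s
    using sampling_index_eq[OF that] by (simp add: sampled_feedback_def)
  have "bounded (range (U i q))" using motion by (simp add: controlled_motion_def)
  then obtain C0 where C0: "\<And>s. \<bar>U i q s\<bar> \<le> C0" unfolding bounded_iff by auto
  \<comment> \<open>At the right end of the interval the feedback already takes a value of the next piece.\<close>
  define C where "C = max C0 \<bar>sampled_feedback U (T (Suc i)) q\<bar>"
  have C: "\<bar>sampled_feedback U s q\<bar> \<le> C" if "s \<in> {T i..T (Suc i)}" for s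
    using that Uq[of s] C0[of "s - T i"] by (cases "s = T (Suc i)") (auto simp: C_def)
  then show "\<exists>C. \<forall>s\<in>{T i..T (Suc i)}. \<bar>sampled_feedback U s q\<bar> \<le> C" by blast
  note eq = controlled_motion_integral_equation[OF smooth_f smooth_g motion, of "T i" "\<lambda>s. sampled_feedback U s q" C t]
  show "(\<lambda>s. f (X i q (s - T i)) + sampled_feedback U s q *\<^sub>R g (X i q (s - T i))) absolutely_integrable_on {T i..t}"
    by (rule eq(1)) (use Uq C t in auto)
  have "X i q (t - T i) = X i q 0 + integral {T i..t} (\<lambda>s. f (X i q (s - T i)) + sampled_feedback U s q *\<^sub>R g (X i q (s - T i)))"
    by (rule eq(2)) (use Uq C t in auto)
  then show "X i q (t - T i) = q + integral {T i..t} (\<lambda>s. f (X i q (s - T i)) + sampled_feedback U s q *\<^sub>R g (X i q (s - T i)))"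
    by (simp add: X0)
qed

abbreviation control_system :: "'a \<Rightarrow> real \<Rightarrow> 'a" where
  "control_system \<equiv> \<lambda>x u. f x + u *\<^sub>R g x"

lemma trajectory_exists:
  assumes law: "feedback_law U X"
  shows "\<exists>x. x 0 = p \<and> sampled_trajectory control_system T (sampled_feedback U) x"
proof -
  define Q where "Q = rec_nat p (\<lambda>i q. X i q (T (Suc i) - T i))"
  have Q: "Q 0 = p" "Q (Suc i) = X i (Q i) (T (Suc i) - T i)" for i
    by (simp_all add: Q_def)
  have X0: "X i q 0 = q" for i q using law by (auto simp: feedback_law_def)
  define x where "x t = X (sampling_index t) (Q (sampling_index t)) (t - T (sampling_index t))" for t
  have at_T: "x (T i) = Q i" for i
    using sampling_index_eq[of i "T i"] T_less[of i "Suc i"] by (simp add: x_def X0)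
  have piece: "x t = X i (Q i) (t - T i)" if t: "t \<in> {T i..T (Suc i)}" for t i
  proof (cases "t = T (Suc i)")
    case True
    then show ?thesis using at_T[of "Suc i"] Q(2) by simp
  next
    case False
    then show ?thesis using t sampling_index_eq[of i t] by (simp add: x_def)
  qed
  have "sampled_trajectory control_system T (sampled_feedback U) x"
    unfolding sampled_trajectory_def
  proof (intro allI ballI conjI)
    fix i t assume t: "t \<in> {T i..T (Suc i)}"
    have eq: "f (x s) + sampled_feedback U s (x (T i)) *\<^sub>R g (x s)
        = f (X i (Q i) (s - T i)) + sampled_feedback U s (Q i) *\<^sub>R g (X i (Q i) (s - T i))"
      if "s \<in> {T i..t}" for s
      using piece[of s i] that t by (simp add: at_T)
    note sol = piece_is_solution[OF law t, of "Q i"]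
    show "(\<lambda>s. f (x s) + sampled_feedback U s (x (T i)) *\<^sub>R g (x s)) absolutely_integrable_on {T i..t}"
      by (rule absolutely_integrable_spike[OF sol(1), of "{}"]) (use eq in auto)
    have "integral {T i..t} (\<lambda>s. f (x s) + sampled_feedback U s (x (T i)) *\<^sub>R g (x s))
        = integral {T i..t} (\<lambda>s. f (X i (Q i) (s - T i)) + sampled_feedback U s (Q i) *\<^sub>R g (X i (Q i) (s - T i)))"
      by (rule Henstock_Kurzweil_Integration.integral_cong) (rule eq)
    then show "x t = x (T i) + integral {T i..t} (\<lambda>s. f (x s) + sampled_feedback U s (x (T i)) *\<^sub>R g (x s))"
      using piece[OF t] sol(2) at_T by simp
  qed
  moreover have "x 0 = p" using at_T[of 0] T0 Q(1) by simp
  ultimately show ?thesis by blast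
qed

lemma trajectory_follows_law:
  assumes law: "feedback_law U X"
    and x: "sampled_trajectory control_system T (sampled_feedback U) x"
    and t: "t \<in> {T i..T (Suc i)}"
  shows "x t = X i (x (T i)) (t - T i)"
proof -
  let ?q = "x (T i)"
  obtain C where C: "\<And>s. s \<in> {T i..T (Suc i)} \<Longrightarrow> \<bar>sampled_feedback U s ?q\<bar> \<le> C"
    using piece_is_solution(3)[OF law t, of ?q] by blast
  show ?thesis
  proof (rule integral_equation_unique[OF smooth_f smooth_g C _ _ _ _ t, of _ _ ?q "\<lambda>s. X i ?q (s - T i)"])
    fix r assume r: "r \<in> {T i..T (Suc i)}"
    show "(\<lambda>s. f (x s) + sampled_feedback U s ?q *\<^sub>R g (x s)) integrable_on {T i..r}"
      "x r = ?q + integral {T i..r} (\<lambda>s. f (x s) + sampled_feedback U s ?q *\<^sub>R g (x s))"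
      using x r set_lebesgue_integral_eq_integral(1) unfolding sampled_trajectory_def by blast+
    show "(\<lambda>s. f (X i ?q (s - T i)) + sampled_feedback U s ?q *\<^sub>R g (X i ?q (s - T i))) integrable_on {T i..r}"
      using piece_is_solution(1)[OF law r] set_lebesgue_integral_eq_integral(1) by blast
    show "X i ?q (r - T i) = ?q + integral {T i..r} (\<lambda>s. f (X i ?q (s - T i)) + sampled_feedback U s ?q *\<^sub>R g (X i ?q (s - T i)))"
      by (rule piece_is_solution(2)[OF law r])
  qed
qed

lemma trajectory_attainable_later:
  assumes law: "feedback_law U X"
    and x: "sampled_trajectory control_system T (sampled_feedback U) x"
    and "attainable j i (x (T i))" "i \<le> i'"
  shows "attainable j i' (x (T i'))"
  using assms(4)
proof (induction i' rule: dec_induct)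
  case (step n)
  have "x (T (Suc n)) = X n (x (T n)) (T (Suc n) - T n)"
    by (rule trajectory_follows_law[OF law x]) (use T_mono[of n "Suc n"] in auto)
  then show ?case using law step.IH unfolding feedback_law_def by simp
qed (rule assms(3))

lemma trajectory_bound:
  assumes law: "feedback_law U X"
    and x: "sampled_trajectory control_system T (sampled_feedback U) x"
    and good: "attainable j i (x (T i))" and t: "T i \<le> t"
  shows "V (x t) \<le> 2 * level j"
proof -
  define n where "n = sampling_index t"
  have "t \<ge> 0" using t T_mono[of 0 i] T0 by simp
  then have n: "T n \<le> t" "t < T (Suc n)" unfolding n_def by (rule sampling_index_bounds)+
  have "i \<le> n" using T_mono[of "Suc n" i] n(2) t by (meson leD leI less_le_trans not_less_eq_eq)
  then have "attainable j n (x (T n))" by (rule trajectory_attainable_later[OF law x good])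
  moreover have "x t = X n (x (T n)) (t - T n)"
    by (rule trajectory_follows_law[OF law x]) (use n in auto)
  ultimately show ?thesis using law n unfolding feedback_law_def by simp
qed

text \<open>Until index \<open>j + 1\<close> becomes attainable, the number of intervals that a plan for \<open>j\<close> needs decreases
  at each sampling time.\<close>
lemma trajectory_improves:
  assumes law: "feedback_law U X"
    and x: "sampled_trajectory control_system T (sampled_feedback U) x"
  shows "attainable j i (x (T i)) \<Longrightarrow> \<exists>i'. attainable (j + 1) i' (x (T i'))"
proof -
  have "plan j i m (x (T i)) \<Longrightarrow> \<exists>i'. attainable (j + 1) i' (x (T i'))" for m
  proof (induction m arbitrary: i rule: less_induct)
    case (less m)
    have next_pt: "x (T (Suc i)) = X i (x (T i)) (T (Suc i) - T i)"
      by (rule trajectory_follows_law[OF law x]) (use T_mono[of i "Suc i"] in auto)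
    have "attainable (j + 1) i (x (T i)) \<or> (\<exists>m'<m. plan j (Suc i) m' (x (T (Suc i))))"
      using law less.prems unfolding feedback_law_def next_pt by blast
    then show ?case using less.IH by blast
  qed
  then show "attainable j i (x (T i)) \<Longrightarrow> \<exists>i'. attainable (j + 1) i' (x (T i'))"
    unfolding attainable_def by blast
qed

lemma trajectory_converges:
  assumes law: "feedback_law U X"
    and x: "sampled_trajectory control_system T (sampled_feedback U) x"
  shows "(x \<longlongrightarrow> 0) at_top"
proof -
  obtain j0 where "V (x (T 0)) \<le> level j0" by (rule level_arbitrarily_large)
  then have good0: "attainable j0 0 (x (T 0))" by (rule attainable_if_below)
  have all_good: "\<exists>i. attainable j i (x (T i))" if "j0 \<le> j" for j
    using that
  proof (induction j rule: int_ge_induct)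
    case base
    then show ?case using good0 by blast
  next
    case (step j)
    then show ?case using trajectory_improves[OF law x] by blast
  qed
  show ?thesis
  proof (rule tendstoI)
    fix \<epsilon> :: real assume "\<epsilon> > 0"
    then obtain a where a: "a > 0" "\<And>z. V z \<le> a \<Longrightarrow> norm z < \<epsilon>" using small_V_small_norm by blast
    have "a / 2 > 0" using a(1) by simp
    then obtain j where j: "j0 \<le> j" "level j < a / 2" by (rule level_arbitrarily_small)
    obtain i where "attainable j i (x (T i))" using all_good[OF j(1)] by blast
    then have "norm (x t) < \<epsilon>" if "T i \<le> t" for t
      using trajectory_bound[OF law x _ that] j(2) by (intro a(2)) fastforce
    then show "eventually (\<lambda>t. dist (x t) 0 < \<epsilon>) at_top"
      unfolding eventually_at_top_linorder by auto
  qed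
qed

lemma trajectories_stable:
  assumes law: "feedback_law U X" and "\<epsilon> > 0"
  shows "\<exists>\<delta>>0. \<forall>x. sampled_trajectory control_system T (sampled_feedback U) x \<and> norm (x 0) \<le> \<delta> \<longrightarrow>
    (\<forall>t\<ge>0. norm (x t) \<le> \<epsilon>)"
proof -
  obtain a where a: "a > 0" "\<And>z. V z \<le> a \<Longrightarrow> norm z < \<epsilon>"
    using small_V_small_norm[OF assms(2)] by blast
  have "a / 2 > 0" using a(1) by simp
  then obtain j where j: "level j < a / 2" using level_arbitrarily_small by blast
  obtain \<delta> where \<delta>: "\<delta> > 0" "\<And>z. norm z \<le> \<delta> \<Longrightarrow> V z \<le> level j"
    using small_norm_small_V[OF level_pos] by blast
  have "norm (x t) \<le> \<epsilon>"
    if x: "sampled_trajectory control_system T (sampled_feedback U) x" and x0: "norm (x 0) \<le> \<delta>"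
      and t: "t \<ge> 0" for x t
  proof -
    have "attainable j 0 (x (T 0))" using attainable_if_below \<delta>(2) x0 T0 by simp
    then have "V (x t) \<le> 2 * level j" by (rule trajectory_bound[OF law x]) (simp add: T0 t)
    then show ?thesis using a(2)[of "x t"] j by simp
  qed
  then show ?thesis using \<delta>(1) by blast
qed

end

theorem (in steerable_lyapunov) sampled_data_stabilizable: "SDF_SGAS (\<lambda>x (u::real). f x + u *\<^sub>R g x)"
  unfolding SDF_SGAS_def
proof (intro conjI allI impI)
  show "f 0 + 0 *\<^sub>R g 0 = 0" by (simp add: f0)
  fix R :: real and T assume "time_partition T"
  then interpret sampled_lyapunov f g V T by unfold_locales
  obtain U X where law: "feedback_law U X" using feedback_law_exists by blast
  show "\<exists>P k. 0 \<in> interior P \<and> cball 0 R \<subseteq> P \<and>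
         (\<forall>p\<in>P. admissible_input (\<lambda>t. k t p)) \<and>
         (\<forall>p\<in>P. \<exists>x. x 0 = p \<and> sampled_trajectory control_system T k x) \<and>
         (\<forall>x. x 0 \<in> P \<and> sampled_trajectory control_system T k x \<longrightarrow> (\<forall>i. x (T i) \<in> P)) \<and>
         (\<forall>\<epsilon>>0. \<exists>\<delta>>0. \<forall>x. x 0 \<in> P \<and> sampled_trajectory control_system T k x \<and> norm (x 0) \<le> \<delta> \<longrightarrow>
            (\<forall>t\<ge>0. norm (x t) \<le> \<epsilon>)) \<and>
         (\<forall>x. x 0 \<in> P \<and> sampled_trajectory control_system T k x \<longrightarrow> (x \<longlongrightarrow> 0) at_top)"
  \<comment> \<open>The feedback is defined globally, so the same domain serves every \<open>R\<close>.\<close>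
  proof (rule exI[of _ UNIV], rule exI[of _ "sampled_feedback U"], intro conjI)
    show "\<forall>\<epsilon>>0. \<exists>\<delta>>0. \<forall>x. x 0 \<in> UNIV \<and> sampled_trajectory control_system T (sampled_feedback U) x \<and> norm (x 0) \<le> \<delta> \<longrightarrow>
            (\<forall>t\<ge>0. norm (x t) \<le> \<epsilon>)"
      using trajectories_stable[OF law] by simp
  qed (use sampled_feedback_admissible[OF law] trajectory_exists[OF law] trajectory_converges[OF law] in auto)
qed

theorem corollary1:
  fixes f g :: "real ^ 3 \<Rightarrow> real ^ 3"
  assumes "smooth f" and "smooth g" and "f 0 = 0"
    and "\<forall>x. span {g x, lie_bracket f g x, lie_bracket f (lie_bracket f g) x} = UNIV"
    and "\<exists>V :: real ^ 3 \<Rightarrow> real.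
          smooth V \<and> positive_definite V \<and> proper V \<and>
          (\<forall>x. x \<noteq> 0 \<longrightarrow> frechet_derivative V (at x) \<noteq> (\<lambda>v. 0)) \<and>
          ((\<forall>x. x \<noteq> 0 \<longrightarrow> lie_deriv g V x = 0 \<longrightarrow> lie_deriv f V x < 0) \<or>
           (\<forall>x. x \<noteq> 0 \<longrightarrow> lie_deriv g V x = 0 \<longrightarrow>
              (\<forall>i\<in>{1, 2, 3::nat}. (lie_deriv f ^^ i) V x = 0)))"
  shows "SDF_SGAS (\<lambda>x (u::real). f x + u *\<^sub>R g x)"
proof -
  obtain V :: "real ^ 3 \<Rightarrow> real" where V: "smooth V" "positive_definite V" "proper V"
    and DV: "\<And>x. x \<noteq> 0 \<Longrightarrow> frechet_derivative V (at x) \<noteq> (\<lambda>v. 0)"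
    and alt: "(\<forall>x. x \<noteq> 0 \<longrightarrow> lie_deriv g V x = 0 \<longrightarrow> lie_deriv f V x < 0) \<or>
           (\<forall>x. x \<noteq> 0 \<longrightarrow> lie_deriv g V x = 0 \<longrightarrow>
              (\<forall>i\<in>{1, 2, 3::nat}. (lie_deriv f ^^ i) V x = 0))"
    using assms(5) by blast
  have V_nonneg: "V x \<ge> 0" for x
    using V(2) unfolding positive_definite_def by (cases "x = 0") (auto intro: less_imp_le)
  have sublevel: "compact {z. V z \<le> b}" for b
  proof -
    have "V -` {0..b} = {z. V z \<le> b}" using V_nonneg by auto
    moreover have "compact (V -` {0..b})" using V(3) unfolding proper_def by auto
    ultimately show ?thesis by simp
  qed
  have "\<exists>r>0. \<exists>d>0. \<forall>q\<in>ball p r. \<exists>y \<tau>. steers f g {z. V z \<le> 2 * V q} q y \<tau> \<and> V y \<le> V q - d"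
    if p: "p \<noteq> 0" for p
  proof -
    \<comment> \<open>Otherwise \<open>DV(p)\<close> would vanish on a spanning set.\<close>
    have "lie_deriv g V p \<noteq> 0 \<or> lie_deriv (lie_bracket f g) V p \<noteq> 0 \<or>
        lie_deriv (lie_bracket f (lie_bracket f g)) V p \<noteq> 0"
    proof (rule ccontr)
      assume "\<not> ?thesis"
      then have zero: "frechet_derivative V (at p) v = 0"
        if "v \<in> {g p, lie_bracket f g p, lie_bracket f (lie_bracket f g) p}" for v
        using that by (auto simp: lie_deriv_def)
      have lin: "linear (frechet_derivative V (at p))"
        using smooth_has_derivative[OF V(1)] has_derivative_linear by blast
      have "frechet_derivative V (at p) v = 0" for v
        by (rule linear_eq_0_on_span[OF lin, of "{g p, lie_bracket f g p, lie_bracket f (lie_bracket f g) p}"])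
           (use zero assms(4) in blast)+
      then show False using DV[OF p] by auto
    qed
    then have cases: "lie_deriv g V p \<noteq> 0 \<or> lie_deriv f V p < 0 \<or>
      (lie_deriv f V p = 0 \<and> lie_deriv f (lie_deriv f V) p = 0 \<and> lie_deriv f (lie_deriv f (lie_deriv f V)) p = 0 \<and>
       (lie_deriv (lie_bracket f g) V p \<noteq> 0 \<or> lie_deriv (lie_bracket f (lie_bracket f g)) V p \<noteq> 0))"
      using alt p by (auto simp: numeral_2_eq_2 numeral_3_eq_3)
    obtain u where u: "continuous_on {0..1} u"
      "\<And>y \<tau>0. scaled_motion f g u p y \<tau>0 \<Longrightarrow>
        \<exists>\<tau>1>0. \<forall>\<tau>. 0 < \<tau> \<and> \<tau> \<le> \<tau>1 \<and> \<tau> \<le> \<tau>0 \<longrightarrow> V (y \<tau> 1) < V p"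
      using exists_decreasing_control[OF V(1) assms(1,2) cases] by blast
    have "V p > 0" using V(2) p by (simp add: positive_definite_def)
    then show ?thesis by (rule local_descent[OF assms(1,2) V(1) _ u(1)]) (rule u(2))
  qed
  then interpret steerable_lyapunov f g V
    using assms(1-3) V(2) sublevel smooth_continuous_on[OF V(1)]
    by unfold_locales (auto simp: positive_definite_def)
  show ?thesis by (rule sampled_data_stabilizable)
qed

end
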